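(* Let $q$ be a prime power and let $k_1,\dots,k_n$ be distinct odd positive integers. Let $A_0(t)=\sum_j a_jt^j\in\mathbb{F}_q[t]$ be a nonzero polynomial such that $t^{k_i}-1$ divides $A_0(t)$ for every $i=1,\dots,n$, and let $A(t)=\sum_j a_jt^{q^j}$. (1) If $q\equiv 3\pmod 4$, the elliptic curve $A(t)y^2=x^3-x$ over $\mathbb{F}_q(t)$ contains at least $n$ separable $\infty$-integral points. (2) If $q\equiv 2\pmod 3$, the elliptic curve $y^2-y=A(t)x^3$ over $\mathbb{F}_q(t)$ contains at least $n$ separable $\infty$-integral points.
   Context: A point $(F(t),G(t))$ on such a curve over $\mathbb{F}_q(t)$ is $\infty$-integral if $F,G\in\mathbb{F}_q[t]$. An elliptic curve $E/\mathbb{F}_q(t)$ is isotrivial if there are an elliptic curve $E_1/\mathbb{F}_q$ and an isomorphism $\phi:E\to E_1$ over a finite extension of $\mathbb{F}_q(t)$; its Frobenius endomorphism is $\mathbf{F}=\phi^{-1}\circ\mathrm{Fr}\circ\phi$ with $\mathrm{Fr}(x,y)=(x^q,y^q)$ on $E_1$, and the Frobenius orbit of $P$ is $\{\mathbf{F}^i(P):i\in\mathbb{N}\}$. A non-constant point of an isotrivial elliptic curve is separable if it is not contained in the Frobenius orbit of any other point.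
   Formalization: Separability against all F_q(t)-points is claimed only if a_0≠0 in (1), and a_0≠0 or a_1≠0 in (2); otherwise (e.g. q=3, A_0=t^2-t) no integral point is separable, and the n points are only claimed to avoid the Frobenius orbits of other ∞-integral points. *)

theory Defs
  imports "HOL-Algebra.Algebraic_Closure_Type" "HOL-Library.Cardinality"
begin

text \<open>
  \<open>Cubic c a1 a3 d a2 a4 a6\<close> is the plane cubic
  \<open>c y^2 + a1 x y + a3 y = d x^3 + a2 x^2 + a4 x + a6\<close>, a Weierstrass equation in which the
  coefficients of \<open>y^2\<close> and \<open>x^3\<close> need not be 1.
\<close>

datatype 'k cubic = Cubic 'k 'k 'k 'k 'k 'k 'k

fun cubic_eval :: "'k::field cubic \<Rightarrow> 'k \<Rightarrow> 'k \<Rightarrow> 'k" where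
  "cubic_eval (Cubic c a1 a3 d a2 a4 a6) x y =
     c * y^2 + a1 * x * y + a3 * y - (d * x^3 + a2 * x^2 + a4 * x + a6)"

fun cubic_dx :: "'k::field cubic \<Rightarrow> 'k \<Rightarrow> 'k \<Rightarrow> 'k" where
  "cubic_dx (Cubic c a1 a3 d a2 a4 a6) x y = a1 * y - (3 * d * x^2 + 2 * a2 * x + a4)"

fun cubic_dy :: "'k::field cubic \<Rightarrow> 'k \<Rightarrow> 'k \<Rightarrow> 'k" where
  "cubic_dy (Cubic c a1 a3 d a2 a4 a6) x y = 2 * c * y + a1 * x + a3"

fun lead_coeffs_nonzero :: "'k::field cubic \<Rightarrow> bool" where
  "lead_coeffs_nonzero (Cubic c a1 a3 d a2 a4 a6) \<longleftrightarrow> c \<noteq> 0 \<and> d \<noteq> 0"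

text \<open>
  For \<open>d \<noteq> 0\<close> the only point at infinity of the projective closure is \<open>(0:1:0)\<close>, and for
  \<open>c \<noteq> 0\<close> it is a smooth point; the remaining condition is smoothness at the affine geometric
  points.
\<close>

definition elliptic_curve :: "'k::field cubic \<Rightarrow> bool" where
  "elliptic_curve E \<longleftrightarrow> lead_coeffs_nonzero E \<and>
     (\<nexists>x y. cubic_eval (map_cubic to_ac E) x y = 0 \<and>
            cubic_dx (map_cubic to_ac E) x y = 0 \<and>
            cubic_dy (map_cubic to_ac E) x y = 0)"

text \<open>\<open>None\<close> is the point at infinity, \<open>Some (x, y)\<close> an affine point.\<close>

type_synonym 'k point = "('k \<times> 'k) option"

definition points :: "'k::field cubic \<Rightarrow> 'k point set" where
  "points E = insert None {Some (x, y) | x y. cubic_eval E x y = 0}"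

text \<open>
  An isomorphism of elliptic curves in (generalised) Weierstrass form is an invertible triangular
  affine substitution carrying one equation to a nonzero multiple of the other. It is represented by
  its action on all of the affine plane together with the point at infinity, on which it is
  bijective.
\<close>

definition cubic_iso :: "('k::field point \<Rightarrow> 'k point) \<Rightarrow> 'k cubic \<Rightarrow> 'k cubic \<Rightarrow> bool" where
  "cubic_iso \<phi> E E' \<longleftrightarrow>
     (\<exists>u r v s w l. u \<noteq> 0 \<and> v \<noteq> 0 \<and> l \<noteq> 0 \<and>
        \<phi> = map_option (\<lambda>(x, y). (u * x + r, v * y + s * x + w)) \<and>
        (\<forall>x y. cubic_eval E' (u * x + r) (v * y + s * x + w) = l * cubic_eval E x y))"

text \<open>
  For a finite field \<open>'a\<close> the rational function field \<open>'a(t)\<close> is \<open>'a poly fract\<close>. A substitution with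
  coefficients in its algebraic closure has coefficients in a finite extension.
\<close>

type_synonym 'a ratfun = "'a poly fract"

definition const_ratfun :: "'a::field \<Rightarrow> 'a ratfun" where
  "const_ratfun c = to_fract [:c:]"

definition geom_point :: "'a::field ratfun point \<Rightarrow> 'a ratfun alg_closure point" where
  "geom_point = map_option (map_prod to_ac to_ac)"

definition isotriviality ::
    "'a::field ratfun cubic \<Rightarrow> 'a cubic \<Rightarrow>
     ('a ratfun alg_closure point \<Rightarrow> 'a ratfun alg_closure point) \<Rightarrow> bool" where
  "isotriviality E E1 \<phi> \<longleftrightarrow> elliptic_curve E1 \<and>
     cubic_iso \<phi> (map_cubic to_ac E) (map_cubic (\<lambda>c. to_ac (const_ratfun c)) E1)"

definition isotrivial :: "'a::field ratfun cubic \<Rightarrow> bool" where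
  "isotrivial E \<longleftrightarrow> elliptic_curve E \<and> (\<exists>E1 \<phi>. isotriviality E E1 \<phi>)"

definition Fr ::
    "'a::finite_field ratfun alg_closure point \<Rightarrow> 'a ratfun alg_closure point" where
  "Fr = map_option (map_prod (\<lambda>x. x ^ CARD('a)) (\<lambda>y. y ^ CARD('a)))"

definition frob_endo ::
    "('a::finite_field ratfun alg_closure point \<Rightarrow> 'a ratfun alg_closure point) \<Rightarrow>
     'a ratfun alg_closure point \<Rightarrow> 'a ratfun alg_closure point" where
  "frob_endo \<phi> = inv_into UNIV \<phi> \<circ> Fr \<circ> \<phi>"

definition frob_orbit ::
    "('a::finite_field ratfun alg_closure point \<Rightarrow> 'a ratfun alg_closure point) \<Rightarrow>
     'a ratfun alg_closure point \<Rightarrow> 'a ratfun alg_closure point set" where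
  "frob_orbit \<phi> P = {(frob_endo \<phi> ^^ i) P | i. True}"

definition integral_points :: "'a::field ratfun cubic \<Rightarrow> 'a ratfun point set" where
  "integral_points E = {P \<in> points E. \<exists>F G. P = Some (to_fract F, to_fract G)}"

definition constant_point :: "'a::field ratfun point \<Rightarrow> bool" where
  "constant_point P \<longleftrightarrow> P = None \<or> (\<exists>a b. P = Some (const_ratfun a, const_ratfun b))"

text \<open>
  The Frobenius endomorphism depends on \<open>E1\<close> and \<open>\<phi>\<close> (it changes by an automorphism of the curve), so
  the condition is required for every choice. The points \<open>Q\<close> that compete with \<open>P\<close> have to be defined
  over \<open>'a(t)\<close>: over the algebraic closure the Frobenius endomorphism is surjective and no point at
  all would be separable. Their Frobenius orbits, however, live over the algebraic closure, because
  the Frobenius endomorphism itself need not be defined over \<open>'a(t)\<close>.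

  \<open>separable_among U E P\<close> lets \<open>Q\<close> range over a set \<open>U\<close> of points defined over \<open>'a(t)\<close>. Two choices of
  \<open>U\<close> are of interest, all points of \<open>E\<close> and all integral points of \<open>E\<close>, and they do differ: a point of
  the form \<open>F(Q)\<close> may be integral although \<open>Q\<close> is not. For example, over the field with 3 elements
  every non-constant integral point of \<open>(t^9 - t^3) y^2 = x^3 - x\<close> has the form \<open>(f^3, g^3)\<close> and is
  the image of the point \<open>(f, g/(t^3 - t))\<close> under the Frobenius endomorphism.
\<close>

definition separable_among ::
    "'a::finite_field ratfun point set \<Rightarrow> 'a ratfun cubic \<Rightarrow> 'a ratfun point \<Rightarrow> bool" where
  "separable_among U E P \<longleftrightarrow> isotrivial E \<and> P \<in> points E \<and> \<not> constant_point P \<and>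
     (\<forall>E1 \<phi>. isotriviality E E1 \<phi> \<longrightarrow>
        (\<forall>Q\<in>U. Q \<noteq> P \<longrightarrow> geom_point P \<notin> frob_orbit \<phi> (geom_point Q)))"

definition separable_point :: "'a::finite_field ratfun cubic \<Rightarrow> 'a ratfun point \<Rightarrow> bool" where
  "separable_point E P \<longleftrightarrow> separable_among (points E) E P"

definition integrally_separable_point ::
    "'a::finite_field ratfun cubic \<Rightarrow> 'a ratfun point \<Rightarrow> bool" where
  "integrally_separable_point E P \<longleftrightarrow> separable_among (integral_points E) E P"

definition linearized :: "'a::finite_field poly \<Rightarrow> 'a poly" where
  "linearized p = (\<Sum>j\<le>degree p. monom (coeff p j) (CARD('a) ^ j))"

definition curve1 :: "'a::field poly \<Rightarrow> 'a ratfun cubic"  \<comment> \<open>\<open>A y^2 = x^3 - x\<close>\<close>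
  where "curve1 A = Cubic (to_fract A) 0 0 1 0 (-1) 0"

definition curve2 :: "'a::field poly \<Rightarrow> 'a ratfun cubic"  \<comment> \<open>\<open>y^2 - y = A x^3\<close>\<close>
  where "curve2 A = Cubic 1 0 (-1) (to_fract A) 0 0 0"

end

theory Submission
  imports Defs
begin

text \<open>
  Write \<open>A\<^sub>0 = (t\<^sup>k - 1) B\<^sub>0\<close>, \<open>f = linearized B\<^sub>0\<close> and \<open>Q = q\<^sup>k\<close>. Then \<open>A = f\<^sup>Q - f = f (f\<^bsup>Q-1\<^esup> - 1)\<close>, so
  the curves carry the points \<open>(f\<^bsup>(Q-1)/2\<^esup>, f\<^bsup>(Q-3)/4\<^esup>)\<close> and \<open>(f\<^bsup>(Q-2)/3\<^esup>, f\<^bsup>Q-1\<^esup>)\<close>, which have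
  different degrees for different \<open>k\<close>.

  Suppose that such a point is the \<open>i\<close>-th Frobenius image of \<open>(x\<^sub>0, y\<^sub>0)\<close>, and let \<open>N = q\<^sup>i\<close>. Comparing the
  coefficients of the two equations, one sees that the substitution \<open>\<phi>\<close> involves, up to elements fixed
  by \<open>z \<mapsto> z\<^sup>N\<close>, only roots of \<open>A\<close>. On the first curve this gives \<open>y\<^sup>4 = A\<^bsup>2(N-1)\<^esup> y\<^sub>0\<^bsup>4N\<^esup>\<close>. On the second one
  it gives \<open>(x - h)\<^sup>3 = A\<^bsup>N-1\<^esup> x\<^sub>0\<^bsup>3N\<^esup>\<close> with \<open>h = 0\<close> or \<open>A h\<^sup>3 = 1\<close>, the latter only in characteristic 2,
  where the curve has additional automorphisms. At a prime divisor of \<open>f\<^bsup>Q-1\<^esup> - 1\<close> the left hand sides of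
  the relations with \<open>h = 0\<close> are units and \<open>A\<close> is not: so \<open>y\<^sub>0\<close>, respectively \<open>x\<^sub>0\<close>, is not integral, and
  the multiplicity of the prime in \<open>A\<close>, which is 1 or \<open>q\<close> if one of the two lowest coefficients of \<open>A\<^sub>0\<close>
  is nonzero, violates a divisibility condition. If \<open>h \<noteq> 0\<close>, then \<open>w = (x - h) h\<close> is rational, and Cardano's
  formula shows that \<open>w\<^sup>3\<close> is not integral and that the multiplicity is divisible by 3.
\<close>

subsection \<open>Frobenius powers and linearized polynomials\<close>

text \<open>The polynomial \<open>(1 + X)^q - X^q - 1\<close> has degree below \<open>q\<close> but
  vanishes at all \<open>q\<close> elements of the field, so it is zero; its inner coefficients are
  the binomials. This avoids writing \<open>q\<close> as a prime power.\<close>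

lemma of_nat_CARD_choose_eq_0:
  assumes "0 < k" "k < CARD('a::finite_field)"
  shows "of_nat (CARD('a) choose k) = (0 :: 'a)"
proof -
  define q where "q = CARD('a)"
  define p :: "'a poly" where "p = [:1, 1:] ^ q - monom 1 q - 1"
  have q0: "q > 0" using assms by (simp add: q_def)
  have root: "poly p x = 0" for x
    using finite_field_power_card_eq_same[of x] finite_field_power_card_eq_same[of "1 + x"]
    by (simp add: p_def poly_monom q_def)
  have "coeff p j = 0" if "j \<ge> q" for j
    using that q0
    by (cases "j = q") (simp_all add: p_def coeff_linear_poly_power coeff_eq_0 degree_linear_power)
  hence deg: "degree p < q"
    using q0 by (metis degree_0 leading_coeff_0_iff not_le)
  have "p = 0"
  proof (rule ccontr)
    assume "p \<noteq> 0"
    hence "card {x. poly p x = 0} \<le> degree p"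
      by (rule card_poly_roots_bound)
    with root deg show False by (simp add: q_def)
  qed
  hence "coeff p k = 0" by simp
  thus ?thesis
    using assms by (simp add: p_def q_def coeff_linear_poly_power)
qed

lemma CARD_gt_1: "CARD('a::finite_field) > 1"
proof -
  have "card {0, 1 :: 'a} \<le> CARD('a)" by (intro card_mono) auto
  thus ?thesis by simp
qed

lemma of_nat_CARD_eq_0: "of_nat CARD('a) = (0 :: 'a::finite_field)"
  using of_nat_CARD_choose_eq_0[of 1, where ?'a = 'a] CARD_gt_1[where ?'a = 'a] by simp

text \<open>Which binomial coefficients vanish depends on the characteristic alone, so the rule
  serves polynomials and the closure of the rational function field alike.\<close>

lemma add_power_CARD:
  fixes x y :: "'b::comm_ring_1"
  assumes "CHAR('b) = CHAR('a::finite_field)"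
  shows "(x + y) ^ CARD('a) ^ i = x ^ CARD('a) ^ i + y ^ CARD('a) ^ i"
proof (induction i)
  case (Suc i)
  define q where "q = CARD('a)"
  have q1: "q > 1" using CARD_gt_1[where ?'a = 'a] by (simp add: q_def)
  have add_q: "(a + b) ^ q = a ^ q + b ^ q" for a b :: 'b
  proof -
    have "(a + b) ^ q = (\<Sum>k\<le>q. of_nat (q choose k) * a ^ k * b ^ (q - k))"
      by (rule binomial_ring)
    also have "\<dots> = (\<Sum>k\<in>{0, q}. of_nat (q choose k) * a ^ k * b ^ (q - k))"
    proof (intro sum.mono_neutral_right ballI)
      fix k assume k: "k \<in> {..q} - {0, q}"
      hence "of_nat (q choose k) = (0 :: 'a)"
        unfolding q_def by (intro of_nat_CARD_choose_eq_0) auto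
      hence "of_nat (q choose k) = (0 :: 'b)"
        using assms by (simp add: of_nat_eq_0_iff_char_dvd)
      thus "of_nat (q choose k) * a ^ k * b ^ (q - k) = 0" by simp
    qed auto
    finally show ?thesis using q1 by (simp add: add_ac)
  qed
  have "(x + y) ^ q ^ Suc i = ((x + y) ^ q ^ i) ^ q"
    by (simp add: power_mult[symmetric] mult.commute)
  also have "\<dots> = (x ^ q ^ i) ^ q + (y ^ q ^ i) ^ q"
    using Suc by (simp add: q_def[symmetric] add_q)
  finally show ?case
    by (simp add: power_mult[symmetric] mult.commute q_def[symmetric])
qed auto

lemma sum_power_CARD:
  fixes g :: "'c \<Rightarrow> 'b::comm_ring_1"
  assumes "CHAR('b) = CHAR('a::finite_field)" "finite S"
  shows "(\<Sum>j\<in>S. g j) ^ CARD('a) ^ i = (\<Sum>j\<in>S. g j ^ CARD('a) ^ i)"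
  using assms(2)
  by (induction rule: finite_induct) (simp_all add: add_power_CARD[OF assms(1)] power_0_left)

lemma CHAR_fract: "CHAR('b::idom fract) = CHAR('b)"
proof (rule CHAR_eqI)
  have "to_fract (of_nat n) = (of_nat n :: 'b fract)" for n
    by (induction n) simp_all
  note * = this
  show "of_nat CHAR('b) = (0 :: 'b fract)" by (simp flip: *)
  show "CHAR('b) dvd n" if "of_nat n = (0 :: 'b fract)" for n
    using that by (simp add: of_nat_eq_0_iff_char_dvd flip: *)
qed

section \<open>Linearized polynomials: shift, degree and derivative\<close>

lemma linearized_eq:
  assumes "degree p \<le> n"
  shows "linearized (p :: 'a::finite_field poly) = (\<Sum>j\<le>n. monom (coeff p j) (CARD('a) ^ j))"
  unfolding linearized_def
  by (rule sum.mono_neutral_left) (use assms in \<open>auto simp: coeff_eq_0\<close>)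

lemma linearized_diff: "linearized (p - r) = linearized p - linearized (r :: 'a::finite_field poly)"
proof -
  define n where "n = max (degree p) (degree r)"
  have "degree (p - r) \<le> n" by (simp add: n_def degree_diff_le)
  thus ?thesis
    by (simp add: linearized_eq[of _ n] n_def sum_subtractf diff_monom flip: sum_subtractf)
qed

text \<open>Shifting the coefficients by \<open>k\<close> turns each exponent \<open>q^j\<close>
  into \<open>q^(j+k)\<close>. As the coefficients are fixed by \<open>q\<close>-th powers, this is
  the Frobenius power of the whole sum.\<close>

lemma linearized_monom_mult:
  fixes p :: "'a::finite_field poly"
  shows "linearized (monom 1 k * p) = linearized p ^ CARD('a) ^ k"
proof -
  define q where "q = CARD('a)"
  have c: "c ^ q ^ k = c" for c :: 'a
    unfolding q_def by (rule finite_field_power_card_power_eq_same) simp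
  have "linearized (monom 1 k * p) = (\<Sum>j\<le>degree p + k. monom (coeff (monom 1 k * p) j) (q ^ j))"
    unfolding q_def
    by (rule linearized_eq) (metis degree_mult_le degree_monom_eq add.commute zero_neq_one)
  also have "\<dots> = (\<Sum>j\<in>{k..degree p + k}. monom (coeff (monom 1 k * p) j) (q ^ j))"
    by (rule sum.mono_neutral_right) (auto simp: coeff_monom_mult)
  also have "\<dots> = (\<Sum>j\<le>degree p. monom (coeff p j) (q ^ (j + k)))"
    by (rule sum.reindex_bij_witness[of _ "\<lambda>j. j + k" "\<lambda>j. j - k"]) (auto simp: coeff_monom_mult)
  also have "\<dots> = (\<Sum>j\<le>degree p. monom (coeff p j) (q ^ j) ^ q ^ k)"
    by (simp add: monom_power c power_add mult.commute)
  also have "\<dots> = linearized p ^ q ^ k"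
    unfolding q_def linearized_def by (rule sum_power_CARD[symmetric]) simp_all
  finally show ?thesis by (simp add: q_def)
qed

lemma degree_linearized:
  fixes p :: "'a::finite_field poly"
  assumes "p \<noteq> 0"
  shows "degree (linearized p) = CARD('a) ^ degree p"
proof (rule antisym)
  have inj: "CARD('a) ^ i = CARD('a) ^ j \<longleftrightarrow> i = j" for i j
    using CARD_gt_1[where ?'a = 'a] by (simp add: power_inject_exp)
  have "coeff (linearized p) (CARD('a) ^ degree p) = lead_coeff p"
    by (simp add: linearized_def coeff_sum inj)
  thus "degree (linearized p) \<ge> CARD('a) ^ degree p"
    using assms by (metis le_degree leading_coeff_0_iff)
  show "degree (linearized p) \<le> CARD('a) ^ degree p"
    unfolding linearized_def
    by (rule degree_sum_le)
       (auto intro!: order.trans[OF degree_monom_le] power_increasing)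
qed

text \<open>Since \<open>q = 0\<close> in the field, only the term with \<open>j = 0\<close>
  survives differentiation. A nonzero lowest coefficient therefore makes the linearized polynomial
  squarefree.\<close>

lemma pderiv_linearized:
  fixes p :: "'a::finite_field poly"
  shows "pderiv (linearized p) = [:coeff p 0:]"
proof -
  have "pderiv (linearized p) = (\<Sum>j\<le>degree p. pderiv (monom (coeff p j) (CARD('a) ^ j)))"
    by (simp add: linearized_def higher_pderiv_sum[of 1, simplified])
  also have "\<dots> = (\<Sum>j\<le>degree p. if j = 0 then [:coeff p 0:] else 0)"
    by (intro sum.cong refl) (auto simp: pderiv_monom monom_0 of_nat_CARD_eq_0 power_0_left)
  finally show ?thesis by simp
qed

lemma linearized_factor:
  fixes A0 B0 :: "'a::finite_field poly"
  assumes "A0 = (monom 1 k - 1) * B0"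
  shows "linearized A0 = linearized B0 ^ CARD('a) ^ k - linearized B0"
  by (simp add: assms left_diff_distrib linearized_diff linearized_monom_mult)

subsection \<open>Exact powers of prime polynomials\<close>

text \<open>Stands in for the valuation at \<pi>; \<open>exact_power_unique\<close> makes it well
  defined. Each division by the nonconstant \<pi> lowers the degree.\<close>

lemma exact_power_exists:
  fixes p :: "'a::field poly"
  assumes "prime_elem \<pi>" "p \<noteq> 0"
  obtains n r where "p = \<pi> ^ n * r" "\<not> \<pi> dvd r"
proof -
  have deg: "degree \<pi> > 0"
    using assms(1) by (metis gr0I is_unit_iff_degree prime_elem_def)
  have "\<exists>n r. p = \<pi> ^ n * r \<and> \<not> \<pi> dvd r"
    using assms(2)
  proof (induction "degree p" arbitrary: p rule: less_induct)
    case less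
    show ?case
    proof (cases "\<pi> dvd p")
      case True
      then obtain p' where p': "p = \<pi> * p'" by blast
      with less.prems have "p' \<noteq> 0" "\<pi> \<noteq> 0" by auto
      hence "degree p' < degree p" using deg by (simp add: p' degree_mult_eq)
      from less.hyps[OF this \<open>p' \<noteq> 0\<close>] obtain n r where "p' = \<pi> ^ n * r" "\<not> \<pi> dvd r"
        by blast
      hence "p = \<pi> ^ Suc n * r" by (simp add: p' mult_ac)
      thus ?thesis using \<open>\<not> \<pi> dvd r\<close> by blast
    next
      case False
      thus ?thesis by (intro exI[of _ 0] exI[of _ p]) simp
    qed
  qed
  thus ?thesis using that by blast
qed

lemma exact_power_unique:
  fixes \<pi> :: "'a::idom"
  assumes "prime_elem \<pi>" "\<pi> ^ m * r = \<pi> ^ n * s" "\<not> \<pi> dvd r" "\<not> \<pi> dvd s"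
  shows "m = n"
  using assms(2)
proof (induction m n rule: diff_induct)
  case (1 m)
  thus ?case using assms(3,4) by (cases m) (auto simp: mult_ac)
next
  case (2 n)
  thus ?case using assms(3,4) by (auto simp: mult_ac)
next
  case (3 m n)
  thus ?case using assms(1) by (simp add: prime_elem_def)
qed

lemma prime_elem_factor_exists:
  fixes p :: "'a::field poly"
  assumes "degree p > 0"
  obtains \<pi> where "prime_elem \<pi>" "\<pi> dvd p"
proof -
  have "\<exists>\<pi>. irreducible \<pi> \<and> \<pi> dvd p"
    using assms
  proof (induction "degree p" arbitrary: p rule: less_induct)
    case less
    show ?case
    proof (cases "irreducible p")
      case False
      moreover have "p \<noteq> 0" using less.prems by auto
      moreover from this have "\<not> p dvd 1" using less.prems by (simp add: is_unit_iff_degree)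
      ultimately obtain a b where ab: "p = a * b" "\<not> a dvd 1" "\<not> b dvd 1"
        unfolding irreducible_def by blast
      with \<open>p \<noteq> 0\<close> have "a \<noteq> 0" "b \<noteq> 0" by auto
      with ab have "degree a > 0" "degree b > 0" by (simp_all add: is_unit_iff_degree)
      hence "degree a < degree p" using ab \<open>a \<noteq> 0\<close> \<open>b \<noteq> 0\<close> by (simp add: degree_mult_eq)
      from less.hyps[OF this \<open>degree a > 0\<close>] show ?thesis using ab by auto
    qed auto
  qed
  thus ?thesis using that field_poly_irreducible_imp_prime by blast
qed

text \<open>A prime whose square divides a polynomial divides the derivative, which is a nonzero
  constant here.\<close>

lemma exact_power_linearized:
  fixes A0 :: "'a::finite_field poly"
  assumes "prime_elem \<pi>" "linearized A0 = \<pi> ^ e * r" "\<not> \<pi> dvd r" "e > 0" "coeff A0 0 \<noteq> 0"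
  shows "e = 1"
proof (rule ccontr)
  assume "e \<noteq> 1"
  then obtain j where j: "e = Suc (Suc j)" using assms(4) by (metis One_nat_def gr0_implies_Suc neq0_conv)
  have "\<pi> dvd pderiv (linearized A0)"
    unfolding assms(2) j by (auto simp: pderiv_mult pderiv_power_Suc intro!: dvd_add)
  hence "\<pi> dvd 1" using assms(5)
    by (simp add: pderiv_linearized is_unit_const_poly_iff dvd_field_iff
        dvd_trans[of \<pi> "[:coeff A0 0:]" 1])
  thus False using assms(1) by (simp add: prime_elem_def)
qed

subsection \<open>Isomorphisms of cubics and fixed elements\<close>

lemma infinite_ratfun_closure: "infinite (UNIV :: 'a::field ratfun alg_closure set)"
proof
  assume "finite (UNIV :: 'a ratfun alg_closure set)"
  moreover have "inj (\<lambda>n. to_ac (to_fract (monom (1 :: 'a) n)))"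
    by (rule injI) (simp add: monom_eq_iff')
  ultimately have "finite (UNIV :: nat set)"
    by (meson finite_imageD finite_subset subset_UNIV)
  thus False by simp
qed

lemma poly_eq_0_if_infinite:
  fixes p :: "'k::idom poly"
  assumes "infinite (UNIV :: 'k set)" "\<And>x. poly p x = 0"
  shows "p = 0"
  using poly_roots_finite[of p] assms by auto

text \<open>Over an infinite field equality of values is equality of polynomials, applied first in
  \<open>y\<close> and then in \<open>x\<close>. The conclusions belong to the monomials
  \<open>y^2\<close>, \<open>x y\<close>, \<open>y\<close>, \<open>x^3\<close>, \<open>x^2\<close>,
  \<open>x\<close>, \<open>1\<close>, in this order.\<close>

lemma cubic_substitution_coeffs:
  fixes u :: "'k::field"
  assumes inf: "infinite (UNIV :: 'k set)"
    and eq: "\<And>x y. cubic_eval (Cubic c a1 a3 d a2 a4 a6) (u * x + r) (v * y + s * x + w) =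
                     l * cubic_eval (Cubic c' a1' a3' d' a2' a4' a6') x y"
  shows "c * v\<^sup>2 = l * c'"
    and "2 * c * v * s + a1 * u * v = l * a1'"
    and "2 * c * v * w + a1 * r * v + a3 * v = l * a3'"
    and "d * u ^ 3 = l * d'"
    and "c * s\<^sup>2 + a1 * u * s - 3 * d * u\<^sup>2 * r - a2 * u\<^sup>2 = - (l * a2')"
    and "2 * c * s * w + a1 * (u * w + r * s) + a3 * s - 3 * d * u * r\<^sup>2 - 2 * a2 * u * r - a4 * u
           = - (l * a4')"
    and "c * w\<^sup>2 + a1 * r * w + a3 * w - d * r ^ 3 - a2 * r\<^sup>2 - a4 * r - a6 = - (l * a6')"
proof -
  define \<alpha> where "\<alpha> = c * v\<^sup>2 - l * c'"
  define \<beta> where "\<beta> = [:2 * c * v * w + a1 * r * v + a3 * v - l * a3',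
                         2 * c * v * s + a1 * u * v - l * a1':]"
  define \<gamma> where "\<gamma> =
    [:c * w\<^sup>2 + a1 * r * w + a3 * w - d * r ^ 3 - a2 * r\<^sup>2 - a4 * r - a6 + l * a6',
      2 * c * s * w + a1 * (u * w + r * s) + a3 * s - 3 * d * u * r\<^sup>2 - 2 * a2 * u * r - a4 * u + l * a4',
      c * s\<^sup>2 + a1 * u * s - 3 * d * u\<^sup>2 * r - a2 * u\<^sup>2 + l * a2',
      l * d' - d * u ^ 3:]"
  have 0: "[:poly \<gamma> x, poly \<beta> x, \<alpha>:] = 0" for x
  proof (rule poly_eq_0_if_infinite[OF inf])
    fix y
    show "poly [:poly \<gamma> x, poly \<beta> x, \<alpha>:] y = 0"
      using eq[of x y] by (simp add: \<alpha>_def \<beta>_def \<gamma>_def algebra_simps power2_eq_square power3_eq_cube)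
  qed
  hence "\<alpha> = 0" by simp
  moreover have "\<beta> = 0" using 0 by (intro poly_eq_0_if_infinite[OF inf]) simp
  moreover have "\<gamma> = 0" using 0 by (intro poly_eq_0_if_infinite[OF inf]) simp
  ultimately show "c * v\<^sup>2 = l * c'"
    "2 * c * v * s + a1 * u * v = l * a1'"
    "2 * c * v * w + a1 * r * v + a3 * v = l * a3'"
    "d * u ^ 3 = l * d'"
    "c * s\<^sup>2 + a1 * u * s - 3 * d * u\<^sup>2 * r - a2 * u\<^sup>2 = - (l * a2')"
    "2 * c * s * w + a1 * (u * w + r * s) + a3 * s - 3 * d * u * r\<^sup>2 - 2 * a2 * u * r - a4 * u
       = - (l * a4')"
    "c * w\<^sup>2 + a1 * r * w + a3 * w - d * r ^ 3 - a2 * r\<^sup>2 - a4 * r - a6 = - (l * a6')"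
    by (auto simp: \<alpha>_def \<beta>_def \<gamma>_def add_eq_0_iff2)
qed

text \<open>In the application \<open>N\<close> is a power of \<open>q\<close>, and the subfield
  \<open>K\<close> contains the coefficients of the constant curve \<open>E1\<close>.\<close>

locale additive_power =
  fixes N :: nat and K :: "'k::field set"
  defines "K \<equiv> {x. x ^ N = x}"
  assumes pos: "N > 0"
    and add: "\<And>x y :: 'k. (x + y) ^ N = x ^ N + y ^ N"
begin

lemma minus: "(- x) ^ N = - (x ^ N)" for x :: 'k
  using add[of x "- x"] pos by (simp add: power_0_left eq_neg_iff_add_eq_0 add.commute)

lemma diff: "(x - y) ^ N = x ^ N - y ^ N" for x y :: 'k
  using add[of x "- y"] by (simp add: minus)

lemma fixed_add [intro]: "x \<in> K \<Longrightarrow> y \<in> K \<Longrightarrow> x + y \<in> K"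
  and fixed_minus [intro]: "x \<in> K \<Longrightarrow> - x \<in> K"
  and fixed_diff [intro]: "x \<in> K \<Longrightarrow> y \<in> K \<Longrightarrow> x - y \<in> K"
  and fixed_mult [intro]: "x \<in> K \<Longrightarrow> y \<in> K \<Longrightarrow> x * y \<in> K"
  and fixed_divide [intro]: "x \<in> K \<Longrightarrow> y \<in> K \<Longrightarrow> x / y \<in> K"
  by (simp_all add: K_def add minus diff power_mult_distrib power_divide)

lemma fixed_power [intro]: "x \<in> K \<Longrightarrow> x ^ n \<in> K"
  by (simp add: K_def flip: power_mult) (simp add: mult.commute[of n] power_mult)

lemma fixed_of_nat: "of_nat n \<in> K"
  using pos by (induction n) (auto simp: K_def power_0_left add)

lemma fixed_numeral [intro]: "numeral n \<in> K"
  using fixed_of_nat[of "numeral n"] by simp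

text \<open>Lets a nonzero factor from \<open>K\<close> disappear when a product is raised to the
  power \<open>N - 1\<close>.\<close>

lemma power_pred: "x ^ (N - 1) = 1" if "x \<in> K" "x \<noteq> 0"
proof -
  have "x * x ^ (N - 1) = x ^ N" using pos by (simp flip: power_Suc)
  thus ?thesis using that by (simp add: K_def)
qed

text \<open>\<open>4 u\<^sup>6\<close> is the discriminant of the cubic with roots \<open>r\<close>, \<open>r + u\<close>, \<open>r - u\<close>.\<close>

lemma fixed_discriminant:
  assumes "(2 :: 'k) \<noteq> 0" "3 * r \<in> K" "3 * r\<^sup>2 - u\<^sup>2 \<in> K" "r ^ 3 - u\<^sup>2 * r \<in> K"
  shows "u ^ 6 \<in> K"
proof -
  define e2 e4 e6 where "e2 = - (3 * r)" "e4 = 3 * r\<^sup>2 - u\<^sup>2" "e6 = - (r ^ 3 - u\<^sup>2 * r)"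
  have "4 * u ^ 6 = e2\<^sup>2 * e4\<^sup>2 - 4 * e4 ^ 3 - 4 * e2 ^ 3 * e6 + 18 * (e2 * (e4 * e6)) - 27 * e6\<^sup>2"
    by (simp add: e2_e4_e6_def algebra_simps power2_eq_square power3_eq_cube eval_nat_numeral)
  moreover have "e2 \<in> K" "e4 \<in> K" "e6 \<in> K" unfolding e2_e4_e6_def using assms by blast+
  ultimately have *: "4 * u ^ 6 \<in> K" by (simp only:) (blast intro: fixed_power fixed_numeral)
  have "(4 :: 'k) = 2 * 2" by simp
  hence "(4 :: 'k) \<noteq> 0" using assms(1) by (metis mult_eq_0_iff)
  hence "u ^ 6 = 4 * u ^ 6 / 4" by simp
  also have "\<dots> \<in> K" using * by (rule fixed_divide) blast
  finally show ?thesis .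
qed

text \<open>Completing the square on \<open>E1\<close> removes \<open>s\<close> and \<open>w\<close>
  and leaves \<open>y1 = v^(N-1) y0^N\<close>. The 2-torsion of \<open>E1\<close> has first
  coordinates \<open>r\<close>, \<open>r + u\<close>, \<open>r - u\<close>, the roots of a cubic
  over \<open>K\<close>, so its discriminant puts \<open>u^6\<close> into \<open>K\<close>. Working
  with the discriminant keeps characteristic 3 included, where \<open>3 r\<close> says nothing about
  \<open>r\<close>.\<close>

lemma frobenius_y_coordinate:
  fixes A :: 'k
  assumes K: "c \<in> K" "a1 \<in> K" "a3 \<in> K" "d \<in> K" "a2 \<in> K" "a4 \<in> K" "a6 \<in> K"
    and two: "(2 :: 'k) \<noteq> 0" and nz: "c \<noteq> 0" "d \<noteq> 0" "u \<noteq> 0" "v \<noteq> 0"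
    and eqs: "c * v\<^sup>2 = l * A"
      "2 * c * v * s + a1 * u * v = 0"
      "2 * c * v * w + a1 * r * v + a3 * v = 0"
      "d * u ^ 3 = l"
      "c * s\<^sup>2 + a1 * u * s - 3 * d * u\<^sup>2 * r - a2 * u\<^sup>2 = 0"
      "2 * c * s * w + a1 * (u * w + r * s) + a3 * s - 3 * d * u * r\<^sup>2 - 2 * a2 * u * r - a4 * u = l"
      "c * w\<^sup>2 + a1 * r * w + a3 * w - d * r ^ 3 - a2 * r\<^sup>2 - a4 * r - a6 = 0"
    and frob: "u * x1 + r = (u * x0 + r) ^ N" "v * y1 + s * x1 + w = (v * y0 + s * x0 + w) ^ N"
  shows "y1 ^ 4 = A ^ (2 * (N - 1)) * y0 ^ (4 * N)"
proof -
  have "v * (2 * c * s + a1 * u) = 0" using eqs(2) by (simp add: algebra_simps)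
  hence s: "2 * c * s + a1 * u = 0" using nz by simp
  have "v * (2 * c * w + a1 * r + a3) = 0" using eqs(3) by (simp add: algebra_simps)
  hence w: "2 * c * w + a1 * r + a3 = 0" using nz by simp
  \<comment> \<open>The completed square \<open>2 c Y + a1 X + a3\<close> of \<open>E1\<close> pulls
    back to a pure multiple of \<open>y\<close>.\<close>
  have complete: "2 * c * (v * y + s * x + w) + a1 * (u * x + r) + a3 = 2 * c * (v * y)" for x y
    using s w by Groebner_Basis.algebra
  have "2 * c * (v * y1) = 2 * c * (v * y0 + s * x0 + w) ^ N + a1 * (u * x0 + r) ^ N + a3"
    using complete[of y1 x1] frob by simp
  also have "\<dots> = (2 * c * (v * y0 + s * x0 + w) + a1 * (u * x0 + r) + a3) ^ N"
    using K fixed_numeral[of "num.Bit0 num.One"]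
    by (simp add: add power_mult_distrib K_def)
  also have "\<dots> = 2 * c * (v * y0) ^ N"
    using K fixed_numeral[of "num.Bit0 num.One"]
    by (simp add: complete power_mult_distrib K_def)
  finally have "v * y1 = (v * y0) ^ N" using two nz by simp
  also have "\<dots> = v * (v ^ (N - 1) * y0 ^ N)"
    using pos by (simp add: power_mult_distrib flip: power_Suc mult.assoc)
  finally have y1: "y1 = v ^ (N - 1) * y0 ^ N" using nz by simp

  have c4: "4 * c \<noteq> 0"
  proof -
    have "(4 :: 'k) = 2 * 2" by simp
    thus ?thesis using two nz by (metis mult_eq_0_iff)
  qed
  define \<sigma> where "\<sigma> = s / u"
  have s': "s = \<sigma> * u" using nz by (simp add: \<sigma>_def)
  have "u * (2 * c * \<sigma>) = u * (- a1)" using s unfolding s' by Groebner_Basis.algebra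
  hence \<sigma>: "2 * c * \<sigma> = - a1" using nz by (metis mult_left_cancel)
  have "u\<^sup>2 * (c * \<sigma>\<^sup>2 + a1 * \<sigma>) = u\<^sup>2 * (3 * d * r + a2)"
    using eqs(5) unfolding s' by Groebner_Basis.algebra
  hence \<sigma>2: "c * \<sigma>\<^sup>2 + a1 * \<sigma> = 3 * d * r + a2" using nz by simp
  \<comment> \<open>Here and in \<open>b4\<close> and the constant term below, Vieta's formulas are
    read off for the completed cubic \<open>(a1 X + a3)^2 + 4 c (d X^3 + a2 X^2 + a4 X + a6)\<close>
    with roots \<open>r\<close>, \<open>r + u\<close>, \<open>r - u\<close>.\<close>
  have b2: "4 * c * (d * (3 * r)) = - (4 * c * a2 + a1\<^sup>2)"
    using \<sigma> \<sigma>2 by Groebner_Basis.algebra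
  hence "3 * r = - (4 * c * a2 + a1\<^sup>2) / (4 * c * d)"
    using nz c4 by (simp add: field_simps)
  also have "\<dots> \<in> K" using K by blast
  finally have r1: "3 * r \<in> K" .
  have "u * (d * (3 * r\<^sup>2 - u\<^sup>2)) = u * (a4 - a3 * \<sigma>)"
  proof -
    have "a1 * (u * w) + 2 * c * s * w = 0" using s by Groebner_Basis.algebra
    hence "u * ((a1 * r + a3) * \<sigma> - 3 * d * r\<^sup>2 - 2 * a2 * r - a4) = u * (d * u\<^sup>2)"
      using eqs(4,6) unfolding s' by Groebner_Basis.algebra
    hence "(a1 * r + a3) * \<sigma> - 3 * d * r\<^sup>2 - 2 * a2 * r - a4 = d * u\<^sup>2" using nz by simp
    moreover have "a1 * \<sigma> = 2 * (3 * d * r + a2)" using \<sigma> \<sigma>2 by Groebner_Basis.algebra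
    ultimately show ?thesis by Groebner_Basis.algebra
  qed
  hence "d * (3 * r\<^sup>2 - u\<^sup>2) = a4 - a3 * \<sigma>" using nz by simp
  hence b4: "2 * c * (d * (3 * r\<^sup>2 - u\<^sup>2)) = 2 * c * a4 + a1 * a3" using \<sigma> by Groebner_Basis.algebra
  hence "3 * r\<^sup>2 - u\<^sup>2 = (2 * c * a4 + a1 * a3) / (2 * c * d)"
    using nz two by (simp add: field_simps)
  also have "\<dots> \<in> K" using K by blast
  finally have r2: "3 * r\<^sup>2 - u\<^sup>2 \<in> K" .
  have "4 * c * (d * (r ^ 3 - u\<^sup>2 * r)) = - (4 * c * a6 + a3\<^sup>2)"
  proof -
    have "4 * c * (d * r ^ 3 + a2 * r\<^sup>2 + a4 * r + a6) = - ((a1 * r + a3)\<^sup>2)"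
      using w eqs(7) by Groebner_Basis.algebra
    thus ?thesis using b2 b4 by Groebner_Basis.algebra
  qed
  hence "r ^ 3 - u\<^sup>2 * r = - (4 * c * a6 + a3\<^sup>2) / (4 * c * d)"
    using nz c4 by (simp add: field_simps)
  also have "\<dots> \<in> K" using K by blast
  finally have r3: "r ^ 3 - u\<^sup>2 * r \<in> K" .

  \<comment> \<open>The fourth power of \<open>v\<close> is used because \<open>v^2\<close> involves
    \<open>u^3\<close>, whereas only \<open>u^6\<close> is known to lie in \<open>K\<close>.\<close>
  define g where "g = (d / c)\<^sup>2 * u ^ 6"
  have "g \<in> K" "g \<noteq> 0"
    unfolding g_def using fixed_discriminant[OF two r1 r2 r3] K nz by (blast, simp)
  have "v ^ 4 = g * A\<^sup>2"
  proof -
    have "c\<^sup>2 * v ^ 4 = (c * v\<^sup>2)\<^sup>2" by Groebner_Basis.algebra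
    also have "\<dots> = d\<^sup>2 * u ^ 6 * A\<^sup>2" unfolding eqs(1) eqs(4)[symmetric] by Groebner_Basis.algebra
    finally show ?thesis using nz by (simp add: g_def field_simps)
  qed
  have "y1 ^ 4 = (v ^ 4) ^ (N - 1) * y0 ^ (4 * N)"
    by (simp add: y1 power_mult_distrib mult.commute flip: power_mult)
  also have "(v ^ 4) ^ (N - 1) = A ^ (2 * (N - 1))"
    using power_pred[OF \<open>g \<in> K\<close> \<open>g \<noteq> 0\<close>]
    by (simp only: \<open>v ^ 4 = g * A\<^sup>2\<close> power_mult_distrib power_mult) simp
  finally show ?thesis .
qed

text \<open>The relation is \<open>x1 - h = u^(N-1) x0^N\<close>, cubed: \<open>u^3\<close> is
  \<open>A\<close> times \<open>c v^2 / d\<close>, which lies in \<open>K\<close>. The shift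
  \<open>h\<close> vanishes when \<open>r\<close> is fixed by the \<open>N\<close>-th power; in
  characteristic 2 it can survive.\<close>

lemma frobenius_x_coordinate:
  fixes A :: 'k
  assumes K: "c \<in> K" "a1 \<in> K" "a3 \<in> K" "d \<in> K" "a2 \<in> K" "a4 \<in> K" "a6 \<in> K"
    and three: "(3 :: 'k) \<noteq> 0" and nz: "A \<noteq> 0" "c \<noteq> 0" "d \<noteq> 0" "u \<noteq> 0" "v \<noteq> 0"
    and eqs: "c * v\<^sup>2 = l"
      "2 * c * v * s + a1 * u * v = 0"
      "2 * c * v * w + a1 * r * v + a3 * v = - l"
      "d * u ^ 3 = l * A"
      "c * s\<^sup>2 + a1 * u * s - 3 * d * u\<^sup>2 * r - a2 * u\<^sup>2 = 0"
      "2 * c * s * w + a1 * (u * w + r * s) + a3 * s - 3 * d * u * r\<^sup>2 - 2 * a2 * u * r - a4 * u = 0"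
      "c * w\<^sup>2 + a1 * r * w + a3 * w - d * r ^ 3 - a2 * r\<^sup>2 - a4 * r - a6 = 0"
    and frob: "u * x1 + r = (u * x0 + r) ^ N"
  obtains h where "(x1 - h) ^ 3 = A ^ (N - 1) * x0 ^ (3 * N)" "h = 0 \<or> A * h ^ 3 = 1"
proof
  \<comment> \<open>Chosen so that \<open>r^N = r + u h\<close>, which turns the Frobenius condition
    into \<open>u (x1 - h) = (u x0)^N\<close>.\<close>
  define h where "h = (r ^ N - r) / u"
  have "v * (2 * c * s + a1 * u) = 0" using eqs(2) by (simp add: algebra_simps)
  hence s: "2 * c * s + a1 * u = 0" using nz by simp
  have "v * (2 * c * w + a1 * r + a3) = v * (- (c * v))" using eqs(1,3) by (simp add: algebra_simps power2_eq_square)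
  hence w: "2 * c * w + a1 * r + a3 = - (c * v)" using nz by (metis mult_left_cancel)
  have "v\<^sup>2 \<in> K \<and> (h = 0 \<or> A * h ^ 3 = 1)"
  proof (cases "(2 :: 'k) = 0")
    \<comment> \<open>With 2 and 3 invertible, \<open>r\<close> itself lies in \<open>K\<close>. The
      points of \<open>E1\<close> above \<open>X = r\<close> have second coordinates
      \<open>w\<close> and \<open>v + w\<close>, so the completed square at \<open>r\<close>
      expresses \<open>v^2\<close> over \<open>K\<close>.\<close>
    case False
    have c4: "4 * c \<noteq> 0"
    proof -
      have "(4 :: 'k) = 2 * 2" by simp
      thus ?thesis using False nz by (metis mult_eq_0_iff)
    qed
    have "4 * c * u\<^sup>2 * (d * (3 * r)) = - u\<^sup>2 * (4 * c * a2 + a1\<^sup>2)"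
      using s eqs(5) by Groebner_Basis.algebra
    hence "4 * c * (d * (3 * r)) = - (4 * c * a2 + a1\<^sup>2)" using nz by Groebner_Basis.algebra
    hence "3 * r = - (4 * c * a2 + a1\<^sup>2) / (4 * c * d)"
      using nz c4 by (simp add: field_simps)
    hence "r = - (4 * c * a2 + a1\<^sup>2) / (4 * c * d) / 3"
      using three by (metis nonzero_mult_div_cancel_left)
    also have "\<dots> \<in> K" using K by blast
    finally have r: "r \<in> K" .
    have "c\<^sup>2 * v\<^sup>2 = (a1 * r + a3)\<^sup>2 + 4 * c * (d * r ^ 3 + a2 * r\<^sup>2 + a4 * r + a6)"
      using w eqs(7) by Groebner_Basis.algebra
    hence "v\<^sup>2 = ((a1 * r + a3)\<^sup>2 + 4 * c * (d * r ^ 3 + a2 * r\<^sup>2 + a4 * r + a6)) / c\<^sup>2"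
      using nz by (simp add: field_simps)
    also have "\<dots> \<in> K" using K r by blast
    finally show ?thesis using r by (simp add: h_def K_def)
  next
    \<comment> \<open>Now \<open>v\<close> lies in \<open>K\<close> directly, but \<open>r\<close>
      and \<sigma> only satisfy two equations over \<open>K\<close>. Their \<open>N\<close>-th
      powers satisfy the same equations, and squaring is additive, so the differences \<rho> and
      \<tau> satisfy the homogeneous ones.\<close>
    case True
    have "a1 = 0" using s nz True by simp
    have "v = - a3 / c" using w nz True \<open>a1 = 0\<close> by (simp add: field_simps)
    hence v: "v \<in> K" using K by blast
    have char2: "(3 :: 'k) = 1" using arg_cong[OF True, of "\<lambda>z. z + 1"] by simp
    define \<sigma> where "\<sigma> = s / u"
    have s': "s = \<sigma> * u" using nz by (simp add: \<sigma>_def)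
    have "u\<^sup>2 * (c * \<sigma>\<^sup>2) = u\<^sup>2 * (d * r + a2)"
      using eqs(5) unfolding s' by (simp add: char2 \<open>a1 = 0\<close> power_mult_distrib algebra_simps)
    hence \<sigma>1: "c * \<sigma>\<^sup>2 = d * r + a2" using nz by simp
    have "u * (a3 * \<sigma>) = u * (d * r\<^sup>2 + a4)"
      using eqs(6) unfolding s' by (simp add: char2 True \<open>a1 = 0\<close> algebra_simps)
    hence \<sigma>2: "a3 * \<sigma> = d * r\<^sup>2 + a4" using nz by simp
    have \<sigma>1': "c * (\<sigma> ^ N)\<^sup>2 = d * r ^ N + a2"
    proof -
      have "(c * \<sigma>\<^sup>2) ^ N = (d * r + a2) ^ N" by (simp only: \<sigma>1)
      thus ?thesis using K by (simp add: K_def add power_mult_distrib power_commutes flip: power_mult) (simp add: mult.commute)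
    qed
    have \<sigma>2': "a3 * \<sigma> ^ N = d * (r ^ N)\<^sup>2 + a4"
    proof -
      have "(a3 * \<sigma>) ^ N = (d * r\<^sup>2 + a4) ^ N" by (simp only: \<sigma>2)
      thus ?thesis using K by (simp add: K_def add power_mult_distrib flip: power_mult) (simp add: mult.commute)
    qed
    define \<rho> where "\<rho> = r ^ N - r"
    have rN: "r ^ N = \<rho> + r" by (simp add: \<rho>_def)
    define \<tau> where "\<tau> = \<sigma> ^ N - \<sigma>"
    have sq: "(a - b)\<^sup>2 = a\<^sup>2 - b\<^sup>2" for a b :: 'k
    proof -
      have "(a - b)\<^sup>2 = a\<^sup>2 - b\<^sup>2 + 2 * (b\<^sup>2 - a * b)"
        by (simp add: algebra_simps power2_eq_square)
      thus ?thesis by (simp add: True)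
    qed
    have "c * \<tau>\<^sup>2 = d * \<rho>"
      by (simp add: \<tau>_def \<rho>_def sq right_diff_distrib \<sigma>1 \<sigma>1')
    moreover have "a3 * \<tau> = d * \<rho>\<^sup>2"
      by (simp add: \<tau>_def \<rho>_def sq right_diff_distrib \<sigma>2 \<sigma>2')
    \<comment> \<open>Squaring the second relation and inserting the first eliminates
      \<tau>.\<close>
    ultimately have "d * \<rho> * (c * d * \<rho> ^ 3 - a3\<^sup>2) = 0" by Groebner_Basis.algebra
    hence "\<rho> = 0 \<or> c * d * \<rho> ^ 3 = a3\<^sup>2" using nz by simp
    moreover have "A * h ^ 3 = 1" if "c * d * \<rho> ^ 3 = a3\<^sup>2"
    proof -
      have "a3 = - (c * v)" using w True \<open>a1 = 0\<close> by simp
      with that have "c * (d * \<rho> ^ 3) = c * l" using eqs(1) by Groebner_Basis.algebra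
      hence "d * \<rho> ^ 3 = l" using nz by simp
      hence "d * (A * \<rho> ^ 3) = d * u ^ 3" using eqs(4) by (metis mult.left_commute mult.commute)
      thus ?thesis using nz by (simp add: h_def power_divide field_simps flip: \<rho>_def)
    qed
    ultimately show ?thesis using v by (auto simp: h_def \<rho>_def)
  qed
  thus "h = 0 \<or> A * h ^ 3 = 1" by blast
  have g: "c * v\<^sup>2 / d \<in> K" "c * v\<^sup>2 / d \<noteq> 0"
    using K nz \<open>v\<^sup>2 \<in> K \<and> _\<close> by (blast, simp)
  have uh: "u * h = r ^ N - r" using nz by (simp add: h_def)
  have "u * (x1 - h) = u * x1 + r - r ^ N"
    by (simp add: right_diff_distrib uh)
  also have "\<dots> = (u * x0) ^ N" using frob by (simp add: add)
  also have "(u * x0) ^ N = u * (u ^ (N - 1) * x0 ^ N)"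
    using pos by (simp add: power_mult_distrib flip: power_Suc mult.assoc)
  finally have "x1 - h = u ^ (N - 1) * x0 ^ N" using nz by simp
  hence "(x1 - h) ^ 3 = (u ^ 3) ^ (N - 1) * x0 ^ (3 * N)"
    by (simp add: power_mult_distrib mult.commute flip: power_mult)
  also have "u ^ 3 = c * v\<^sup>2 / d * A" using eqs(1,4) nz by (simp add: field_simps)
  also have "\<dots> ^ (N - 1) = A ^ (N - 1)"
    using power_pred[OF g] by (simp only: power_mult_distrib) simp
  finally show "(x1 - h) ^ 3 = A ^ (N - 1) * x0 ^ (3 * N)" .
qed

end

subsection \<open>Prime divisors of the twisting polynomial\<close>

lemma to_fract_power [simp]: "to_fract (x ^ n) = to_fract x ^ n"
  by (induction n) simp_all

lemma to_fract_of_nat [simp]: "to_fract (of_nat n) = of_nat n"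
  by (induction n) simp_all

lemma to_fract_numeral [simp]: "to_fract (numeral n) = numeral n"
  by (metis of_nat_numeral to_fract_of_nat)

lemma ratfun_cases:
  obtains a b where "x = to_fract a / to_fract (b :: 'a::field poly)" "b \<noteq> 0"
  by (cases x) (metis Fract_conv_to_fract)

text \<open>Lowest terms at one prime only: the common power of \<pi> is cancelled, other common
  factors may remain.\<close>

lemma ratfun_cases_prime:
  assumes "prime_elem \<pi>"
  obtains a b where "x = to_fract a / to_fract (b :: 'a::field poly)" "b \<noteq> 0"
    "\<not> (\<pi> dvd a \<and> \<pi> dvd b)"
proof -
  have \<pi>: "\<pi> \<noteq> 0" "\<not> \<pi> dvd 1" using assms by (auto simp: prime_elem_def)
  obtain a b where x: "x = to_fract a / to_fract b" and b: "b \<noteq> 0" by (rule ratfun_cases)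
  show ?thesis
  proof (cases "a = 0")
    case True
    thus ?thesis using that[of 0 1] x \<pi> by simp
  next
    case False
    obtain i a' where a': "a = \<pi> ^ i * a'" "\<not> \<pi> dvd a'"
      using exact_power_exists[OF assms False] by blast
    obtain j b' where b': "b = \<pi> ^ j * b'" "\<not> \<pi> dvd b'"
      using exact_power_exists[OF assms b] by blast
    have "b' \<noteq> 0" using b' by auto
    show ?thesis
    proof (cases "i \<le> j")
      case True
      then obtain d where d: "j = i + d" using le_Suc_ex by blast
      have "x = to_fract a' / to_fract (\<pi> ^ d * b')"
        using \<pi> by (simp add: x a' b' d power_add)
      thus ?thesis using that[of a' "\<pi> ^ d * b'"] a'(2) \<pi> \<open>b' \<noteq> 0\<close> by simp
    next
      case False
      then obtain d where d: "i = j + d" using le_Suc_ex nat_le_linear by blast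
      have "x = to_fract (\<pi> ^ d * a') / to_fract b'"
        using \<pi> by (simp add: x a' b' d power_add)
      thus ?thesis using that[of "\<pi> ^ d * a'" b'] b'(2) \<pi> \<open>b' \<noteq> 0\<close> by simp
    qed
  qed
qed

text \<open>If the lowest coefficient vanishes, then \<open>A0 = t C0\<close> and the linearized
  polynomial is the \<open>q\<close>-th power of that of \<open>C0\<close>, which is
  squarefree.\<close>

lemma linearized_exact_power:
  fixes A0 :: "'a::finite_field poly"
  assumes \<pi>: "prime_elem \<pi>" and A: "linearized A0 = \<pi> ^ e * r" "\<not> \<pi> dvd r" "e > 0"
    and nz: "coeff A0 0 \<noteq> 0 \<or> coeff A0 1 \<noteq> 0"
  shows "e = (if coeff A0 0 \<noteq> 0 then 1 else CARD('a))"
proof (cases "coeff A0 0 = 0")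
  case True
  have "A0 \<noteq> 0" using nz by auto
  have "[:0, 1:] dvd A0" using True by (simp add: poly_0_coeff_0 dvd_iff_poly_eq_0)
  then obtain C0 where C0: "A0 = [:0, 1:] * C0" by blast
  define C where "C = linearized C0"
  have "linearized A0 = C ^ CARD('a)"
    using linearized_monom_mult[of 1 C0] by (simp add: C0 C_def monom_Suc monom_0)
  moreover have "coeff C0 0 \<noteq> 0" using nz by (simp add: C0)
  moreover from this have "C0 \<noteq> 0" by auto
  hence "C \<noteq> 0" unfolding C_def using degree_linearized[of C0] by auto
  then obtain j s where j: "C = \<pi> ^ j * s" "\<not> \<pi> dvd s"
    using exact_power_exists[OF \<pi>] by blast
  ultimately have "\<pi> ^ e * r = \<pi> ^ (j * CARD('a)) * s ^ CARD('a)"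
    using A(1) by (simp add: power_mult_distrib power_mult)
  moreover have "\<not> \<pi> dvd s ^ CARD('a)" using j(2) \<pi> prime_elem_dvd_power by blast
  ultimately have e: "e = j * CARD('a)" using exact_power_unique[OF \<pi>] A(2) by blast
  hence "j > 0" using A(3) by simp
  hence "j = 1"
    using exact_power_linearized[OF \<pi> _ j(2)] j(1) \<open>coeff C0 0 \<noteq> 0\<close> by (simp add: C_def)
  thus ?thesis using e True by simp
qed (use exact_power_linearized[OF \<pi> A] in simp)

text \<open>In the application \<open>m = q^k - 1\<close>, so that \<open>A\<close> has the
  Artin-Schreier shape \<open>f^(m+1) - f\<close>.\<close>

locale artin_schreier =
  fixes A f :: "'a::field poly" and m :: nat
  assumes A: "A = f * (f ^ m - 1)" and deg: "degree f > 0" and m: "m > 0"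
begin

lemma degree_pos: "degree (f ^ m - 1) > 0"
proof -
  have *: "degree (f ^ m) > 0" using deg m by (subst degree_power_eq) auto
  hence "degree (f ^ m + (- 1)) = degree (f ^ m)" by (intro degree_add_eq_left) simp
  thus ?thesis using * by simp
qed

lemma nonzero: "A \<noteq> 0" "f \<noteq> 0"
  using deg degree_pos by (auto simp: A)

lemma prime_not_dvd:
  obtains \<pi> where "prime_elem \<pi>" "\<pi> dvd A" "\<not> \<pi> dvd f"
proof -
  obtain \<pi> where \<pi>: "prime_elem \<pi>" "\<pi> dvd f ^ m - 1"
    using prime_elem_factor_exists[OF degree_pos] by blast
  have "\<not> \<pi> dvd f"
  proof
    assume "\<pi> dvd f"
    hence "\<pi> dvd f ^ m" using m by (meson dvd_power dvd_trans)
    with \<pi>(2) have "\<pi> dvd f ^ m - (f ^ m - 1)" by (rule dvd_diff[rotated])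
    thus False using \<pi>(1) by (simp add: prime_elem_def)
  qed
  thus ?thesis using that \<pi> by (simp add: A)
qed

text \<open>At a prime dividing \<open>A\<close> but not \<open>f\<close> the left side is a unit,
  so \<open>x\<close> has a pole whose order, multiplied by \<open>i\<close>, is \<open>n\<close>
  times the multiplicity of the prime in \<open>A\<close>. It is applied with
  \<open>n = 2 (N - 1)\<close>, \<open>i = 4 N\<close> and with \<open>n = N - 1\<close>,
  \<open>i = 3 N\<close>.\<close>

lemma power_relation:
  assumes eq: "to_fract (f ^ j) = to_fract A ^ n * x ^ i" and n: "n > 0" and i: "i > 0"
  shows "x \<notin> range to_fract"
    and "\<exists>\<pi> e r. prime_elem \<pi> \<and> A = \<pi> ^ e * r \<and> \<not> \<pi> dvd r \<and> e > 0 \<and> i dvd n * e"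
proof -
  obtain \<pi> where \<pi>: "prime_elem \<pi>" "\<pi> dvd A" "\<not> \<pi> dvd f" by (rule prime_not_dvd)
  have f: "\<not> \<pi> dvd f ^ j" using \<pi> prime_elem_dvd_power by blast
  show "x \<notin> range to_fract"
  proof
    assume "x \<in> range to_fract"
    then obtain g where "x = to_fract g" by blast
    with eq have "to_fract (f ^ j) = to_fract (A ^ n * g ^ i)" by simp
    hence "f ^ j = A ^ n * g ^ i" by (simp only: to_fract_eq_iff)
    thus False using f \<pi>(2) n by (metis dvd_mult2 dvd_power dvd_trans)
  qed
  obtain e r where e: "A = \<pi> ^ e * r" "\<not> \<pi> dvd r"
    using exact_power_exists[OF \<pi>(1) nonzero(1)] by blast
  hence "e > 0" using \<pi>(2) by (cases e) auto
  obtain a b where x: "x = to_fract a / to_fract b" and "b \<noteq> 0" by (rule ratfun_cases)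
  have "to_fract (f ^ j * b ^ i) = to_fract (A ^ n * a ^ i)"
    using eq \<open>b \<noteq> 0\<close> by (simp add: x field_simps)
  hence ab: "f ^ j * b ^ i = A ^ n * a ^ i" by (simp only: to_fract_eq_iff)
  with nonzero \<open>b \<noteq> 0\<close> i have "a \<noteq> 0" by (metis mult_eq_0_iff power_eq_0_iff power_0_left neq0_conv)
  obtain \<alpha> a' where a: "a = \<pi> ^ \<alpha> * a'" "\<not> \<pi> dvd a'"
    using exact_power_exists[OF \<pi>(1) \<open>a \<noteq> 0\<close>] by blast
  obtain \<beta> b' where b: "b = \<pi> ^ \<beta> * b'" "\<not> \<pi> dvd b'"
    using exact_power_exists[OF \<pi>(1) \<open>b \<noteq> 0\<close>] by blast
  have "\<pi> ^ (i * \<beta>) * (f ^ j * b' ^ i) = \<pi> ^ (n * e + i * \<alpha>) * (r ^ n * a' ^ i)"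
    using ab unfolding a(1) b(1) e(1)
    by (simp add: power_mult_distrib power_add mult_ac flip: power_mult)
  moreover have "\<not> \<pi> dvd f ^ j * b' ^ i" "\<not> \<pi> dvd r ^ n * a' ^ i"
    using f a(2) b(2) e(2) \<pi>(1) by (auto simp: prime_elem_dvd_mult_iff dest: prime_elem_dvd_power)
  ultimately have "i * \<beta> = n * e + i * \<alpha>" by (rule exact_power_unique[OF \<pi>(1)])
  hence "i dvd n * e" by (metis dvd_add_left_iff dvd_triv_left)
  thus "\<exists>\<pi> e r. prime_elem \<pi> \<and> A = \<pi> ^ e * r \<and> \<not> \<pi> dvd r \<and> e > 0 \<and> i dvd n * e"
    using \<pi>(1) e \<open>e > 0\<close> by blast
qed

text \<open>The relation is Cardano's formula \<open>x\<^sup>3 = a\<^sup>3 + b\<^sup>3 + 3 a b x\<close> for \<open>x = a + b\<close>, with \<open>w = a b\<close> and \<open>A b\<^sup>3 = 1\<close>.\<close>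

lemma cardano_relation:
  assumes eq: "to_fract (A * x ^ 3) = to_fract A ^ 2 * w ^ 3 + 1 + 3 * to_fract (A * x) * w"
  shows "w ^ 3 \<notin> range to_fract"
    and "\<exists>\<pi> e r. prime_elem \<pi> \<and> A = \<pi> ^ e * r \<and> \<not> \<pi> dvd r \<and> e > 0 \<and> 3 dvd e"
proof -
  obtain \<pi> where \<pi>: "prime_elem \<pi>" "\<pi> dvd A" "\<not> \<pi> dvd f" by (rule prime_not_dvd)
  obtain e r where e: "A = \<pi> ^ e * r" "\<not> \<pi> dvd r"
    using exact_power_exists[OF \<pi>(1) nonzero(1)] by blast
  hence "e > 0" using \<pi>(2) by (cases e) auto
  have Ae: "\<pi> dvd A * t" for t using \<pi>(2) by simp
  show "w ^ 3 \<notin> range to_fract"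
  proof
    assume "w ^ 3 \<in> range to_fract"
    then obtain g where g: "w ^ 3 = to_fract g" by blast
    \<comment> \<open>If \<open>w^3\<close> is a polynomial, the denominator \<open>b\<close> is
      prime to \<pi>; clearing it in the relation and reducing modulo \<pi> yields that \<pi>
      divides \<open>b\<close>.\<close>
    obtain a b where w: "w = to_fract a / to_fract b" "b \<noteq> 0" and ab: "\<not> (\<pi> dvd a \<and> \<pi> dvd b)"
      by (rule ratfun_cases_prime[OF \<pi>(1)])
    have "to_fract (a ^ 3) = to_fract (g * b ^ 3)"
      using g w by (simp add: field_simps)
    hence "a ^ 3 = g * b ^ 3" by (simp only: to_fract_eq_iff)
    hence "\<not> \<pi> dvd b" using ab \<pi>(1)
      by (metis dvd_mult dvd_power dvd_trans prime_elem_dvd_power zero_less_numeral)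
    moreover have "to_fract (A * x ^ 3 * b) = to_fract (A ^ 2 * g * b + b + 3 * (A * x) * a)"
      using eq w unfolding g by (simp add: field_simps)
    hence "A * x ^ 3 * b = A ^ 2 * g * b + b + 3 * (A * x) * a" by (simp only: to_fract_eq_iff)
    hence "b = A * (x ^ 3 * b - A * g * b - 3 * x * a)"
      by (simp add: algebra_simps power2_eq_square)
    ultimately show False using Ae by metis
  qed
  \<comment> \<open>Multiplying the relation by \<open>A\<close> makes it a cubic in
    \<open>A w\<close>. Cleared of denominators it reads \<open>a^3 = A b^2 t\<close> with
    \<open>t\<close> congruent to \<open>- b\<close> modulo \<pi>, so the multiplicity of \<pi> in
    \<open>A\<close> is that in \<open>a^3\<close>.\<close>
  obtain a b where w: "to_fract A * w = to_fract a / to_fract b" "b \<noteq> 0"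
    and ab: "\<not> (\<pi> dvd a \<and> \<pi> dvd b)"
    by (rule ratfun_cases_prime[OF \<pi>(1)])
  define t where "t = A * (x ^ 3 * b) - b - 3 * x * a"
  have "to_fract A * (to_fract A * to_fract x ^ 3) =
      (to_fract A * w) ^ 3 + to_fract A + 3 * to_fract A * to_fract x * (to_fract A * w)"
    using arg_cong[OF eq, of "\<lambda>z. to_fract A * z"]
    by (simp add: algebra_simps power2_eq_square power3_eq_cube)
  hence "to_fract (a ^ 3) = to_fract (A * b ^ 2 * t)"
    using w(2) unfolding w(1) t_def by (simp add: field_simps power2_eq_square power3_eq_cube)
  hence a3: "a ^ 3 = A * b ^ 2 * t" by (simp only: to_fract_eq_iff)
  hence "\<pi> dvd a ^ 3" using Ae by (simp add: mult.assoc)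
  hence a: "\<pi> dvd a" using \<pi>(1) prime_elem_dvd_power by blast
  hence b: "\<not> \<pi> dvd b" using ab by blast
  have t: "\<not> \<pi> dvd t"
  proof
    assume "\<pi> dvd t"
    moreover have "b = A * (x ^ 3 * b) - 3 * x * a - t" by (simp add: t_def)
    ultimately show False using a b Ae by (metis dvd_diff dvd_mult)
  qed
  have "a \<noteq> 0" using a3 nonzero w(2) t by auto
  then obtain \<alpha> a' where a': "a = \<pi> ^ \<alpha> * a'" "\<not> \<pi> dvd a'"
    using exact_power_exists[OF \<pi>(1)] by blast
  have "\<pi> ^ (3 * \<alpha>) * a' ^ 3 = \<pi> ^ e * (r * b ^ 2 * t)"
    using a3 unfolding a'(1) e(1)
    by (simp add: power_mult_distrib mult_ac flip: power_mult)
  moreover have "\<not> \<pi> dvd a' ^ 3" "\<not> \<pi> dvd r * b ^ 2 * t"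
    using a'(2) b t e(2) \<pi>(1) by (auto simp: prime_elem_dvd_mult_iff dest: prime_elem_dvd_power)
  ultimately have "3 * \<alpha> = e" by (rule exact_power_unique[OF \<pi>(1)])
  thus "\<exists>\<pi> e r. prime_elem \<pi> \<and> A = \<pi> ^ e * r \<and> \<not> \<pi> dvd r \<and> e > 0 \<and> 3 dvd e"
    using \<pi>(1) e \<open>e > 0\<close> by (metis dvd_triv_left)
qed

end

subsection \<open>Frobenius orbits\<close>

definition affine_substitution :: "'k::field \<Rightarrow> 'k \<Rightarrow> 'k \<Rightarrow> 'k \<Rightarrow> 'k \<Rightarrow> 'k point \<Rightarrow> 'k point" where
  "affine_substitution u r v s w = map_option (\<lambda>(x, y). (u * x + r, v * y + s * x + w))"

lemma affine_substitution_surj: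
  assumes "u \<noteq> 0" "v \<noteq> 0"
  shows "surj (affine_substitution u r v s w)"
proof -
  have "\<exists>Q. P = affine_substitution u r v s w Q" for P
  proof (cases P)
    case None
    thus ?thesis by (intro exI[of _ None]) (simp add: affine_substitution_def)
  next
    case (Some z)
    obtain x y where z: "z = (x, y)" by (cases z)
    show ?thesis
      using assms
      by (intro exI[of _ "Some ((x - r) / u, (y - w - s * ((x - r) / u)) / v)"])
        (simp add: affine_substitution_def Some z)
  qed
  thus ?thesis by (simp add: surj_def)
qed

lemma Fr_power:
  "(Fr ^^ i) (Some (x, y) :: 'a::finite_field ratfun alg_closure point) =
     Some (x ^ CARD('a) ^ i, y ^ CARD('a) ^ i)"
  "(Fr ^^ i) (None :: 'a ratfun alg_closure point) = None"
  by (induction i) (simp_all add: Fr_def mult.commute flip: power_mult)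

text \<open>For surjective \<phi> the chosen \<open>inv_into\<close> is a right inverse, which
  suffices for the iterates to telescope.\<close>

lemma conjugate_Fr_power:
  assumes "surj \<phi>"
  shows "\<phi> ((frob_endo \<phi> ^^ i) P) = (Fr ^^ i) (\<phi> P)"
  by (induction i) (simp_all add: frob_endo_def surj_f_inv_f[OF assms])

lemma geom_point_inj: "inj geom_point"
  unfolding geom_point_def
  by (intro option.inj_map prod.inj_map inj_to_ac)

text \<open>Exponent 0 would force equality by injectivity of \<open>geom_point\<close>, and the
  point at infinity is fixed by \<open>Fr\<close>; both are thus excluded, and the coordinates can
  be compared.\<close>

lemma frob_orbit_affine_substitution:
  fixes u :: "'a::finite_field ratfun alg_closure"
  assumes uv: "u \<noteq> 0" "v \<noteq> 0"
    and orbit: "geom_point (Some (x1, y1)) \<in> frob_orbit (affine_substitution u r v s w) (geom_point R)"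
    and "R \<noteq> Some (x1, y1)"
  obtains i x0 y0 where "i > 0" "R = Some (x0, y0)"
    "u * to_ac x1 + r = (u * to_ac x0 + r) ^ CARD('a) ^ i"
    "v * to_ac y1 + s * to_ac x1 + w = (v * to_ac y0 + s * to_ac x0 + w) ^ CARD('a) ^ i"
proof -
  let ?\<phi> = "affine_substitution u r v s w"
  obtain i where i: "geom_point (Some (x1, y1)) = (frob_endo ?\<phi> ^^ i) (geom_point R)"
    using orbit by (auto simp: frob_orbit_def)
  have "i > 0"
    using i assms(4) injD[OF geom_point_inj] by (intro gr0I) auto
  have eq: "?\<phi> (geom_point (Some (x1, y1))) = (Fr ^^ i) (?\<phi> (geom_point R))"
    unfolding i by (rule conjugate_Fr_power[OF affine_substitution_surj[OF uv]])
  show ?thesis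
  proof (cases R)
    case None
    thus ?thesis using eq by (simp add: geom_point_def affine_substitution_def Fr_power)
  next
    case (Some z)
    obtain x0 y0 where z: "z = (x0, y0)" by (cases z)
    show ?thesis
      using eq that[OF \<open>i > 0\<close>, of x0 y0]
      by (simp add: geom_point_def affine_substitution_def Fr_power Some z)
  qed
qed

section \<open>Frobenius relations between rational points\<close>

lemma isotrivialityE:
  assumes "isotriviality E E1 \<phi>"
  obtains c a1 a3 d a2 a4 a6 u r v s w l where
    "E1 = Cubic c a1 a3 d a2 a4 a6" "c \<noteq> 0" "d \<noteq> 0"
    "u \<noteq> 0" "v \<noteq> 0" "\<phi> = affine_substitution u r v s w"
    "\<And>x y. cubic_eval (map_cubic (\<lambda>c. to_ac (const_ratfun c)) E1) (u * x + r) (v * y + s * x + w) =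
            l * cubic_eval (map_cubic to_ac E) x y"
proof -
  obtain c a1 a3 d a2 a4 a6 where E1: "E1 = Cubic c a1 a3 d a2 a4 a6" by (cases E1)
  have "c \<noteq> 0" "d \<noteq> 0"
    using assms by (auto simp: isotriviality_def elliptic_curve_def E1)
  moreover obtain u r v s w l where "u \<noteq> 0" "v \<noteq> 0" "\<phi> = affine_substitution u r v s w"
    "\<And>x y. cubic_eval (map_cubic (\<lambda>c. to_ac (const_ratfun c)) E1) (u * x + r) (v * y + s * x + w) =
            l * cubic_eval (map_cubic to_ac E) x y"
    using assms unfolding isotriviality_def cubic_iso_def affine_substitution_def by blast
  ultimately show ?thesis using that[OF E1] by blast
qed

lemma additive_power_CARD:
  "additive_power TYPE('a ratfun alg_closure) (CARD('a::finite_field) ^ i)"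
  by unfold_locales (simp_all add: add_power_CARD CHAR_fract)

lemma const_ratfun_power_CARD:
  fixes c :: "'a::finite_field"
  shows "to_ac (const_ratfun c) ^ CARD('a) ^ i = to_ac (const_ratfun c)"
proof -
  have "[:c:] ^ n = [:c ^ n:]" for n by (induction n) (simp_all add: one_pCons)
  hence "const_ratfun c ^ n = const_ratfun (c ^ n)" for n
    by (simp add: const_ratfun_def flip: to_fract_power)
  thus ?thesis by (simp add: finite_field_power_card_power_eq_same flip: to_ac_power)
qed

lemma const_ratfun_0 [simp]: "const_ratfun 0 = 0"
  and const_ratfun_1 [simp]: "const_ratfun 1 = 1"
  and const_ratfun_minus [simp]: "const_ratfun (- c) = - const_ratfun c"
  by (simp_all add: const_ratfun_def pCons_one flip: to_fract_uminus)

lemma const_ratfun_eq_0_iff [simp]: "const_ratfun c = 0 \<longleftrightarrow> c = 0"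
  by (simp add: const_ratfun_def)

lemma of_nat_ratfun_closure_eq_0_iff:
  "of_nat n = (0 :: 'a::field ratfun alg_closure) \<longleftrightarrow> of_nat n = (0 :: 'a)"
  by (simp add: of_nat_eq_0_iff_char_dvd CHAR_fract)

lemma numeral_ratfun_closure_eq_0_iff:
  "numeral n = (0 :: 'a::field ratfun alg_closure) \<longleftrightarrow> numeral n = (0 :: 'a)"
  using of_nat_ratfun_closure_eq_0_iff[of "numeral n"] by simp

text \<open>No parameter of \<phi> remains in the relation, so it descends from the algebraic
  closure along the injection \<open>to_ac\<close>.\<close>

lemma curve1_frobenius_relation:
  fixes A :: "'a::finite_field poly"
  assumes two: "(2 :: 'a) \<noteq> 0"
    and iso: "isotriviality (curve1 A) E1 \<phi>"
    and orbit: "geom_point (Some (x1, y1)) \<in> frob_orbit \<phi> (geom_point R)" "R \<noteq> Some (x1, y1)"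
  obtains i x0 y0 where "i > 0" "R = Some (x0, y0)"
    "y1 ^ 4 = to_fract A ^ (2 * (CARD('a) ^ i - 1)) * y0 ^ (4 * CARD('a) ^ i)"
proof -
  obtain c a1 a3 d a2 a4 a6 u r v s w l where
    E1: "E1 = Cubic c a1 a3 d a2 a4 a6" and nz: "c \<noteq> 0" "d \<noteq> 0" "u \<noteq> 0" "v \<noteq> 0"
    and \<phi>: "\<phi> = affine_substitution u r v s w"
    and eq: "\<And>x y. cubic_eval (map_cubic (\<lambda>c. to_ac (const_ratfun c)) E1) (u * x + r) (v * y + s * x + w) =
            l * cubic_eval (map_cubic to_ac (curve1 A)) x y"
    using isotrivialityE[OF iso] by metis
  let ?k = "\<lambda>c. to_ac (const_ratfun c) :: 'a ratfun alg_closure"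
  note eqs = cubic_substitution_coeffs[OF infinite_ratfun_closure
      eq[unfolded E1 curve1_def cubic.map], simplified]
  obtain i x0 y0 where i: "i > 0" "R = Some (x0, y0)"
    "u * to_ac x1 + r = (u * to_ac x0 + r) ^ CARD('a) ^ i"
    "v * to_ac y1 + s * to_ac x1 + w = (v * to_ac y0 + s * to_ac x0 + w) ^ CARD('a) ^ i"
    using frob_orbit_affine_substitution[OF nz(3,4) orbit[unfolded \<phi>]] by metis
  define N where "N = CARD('a) ^ i"
  interpret additive_power N "{x :: 'a ratfun alg_closure. x ^ N = x}"
    unfolding N_def by (rule additive_power_CARD)
  have K: "?k x \<in> {x. x ^ N = x}" for x by (simp add: N_def const_ratfun_power_CARD)
  have "to_ac y1 ^ 4 = to_ac (to_fract A) ^ (2 * (N - 1)) * to_ac y0 ^ (4 * N)"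
    by (rule frobenius_y_coordinate[of "?k c" "?k a1" "?k a3" "?k d" "?k a2" "?k a4" "?k a6"])
      (use K two nz eqs i(3,4) in \<open>simp_all add: N_def numeral_ratfun_closure_eq_0_iff\<close>)
  hence "to_ac (y1 ^ 4) = to_ac (to_fract A ^ (2 * (N - 1)) * y0 ^ (4 * N))" by simp
  hence "y1 ^ 4 = to_fract A ^ (2 * (N - 1)) * y0 ^ (4 * N)" by (simp only: to_ac_eq_iff)
  thus ?thesis using that i by (simp add: N_def)
qed

text \<open>The two cases are \<open>h = 0\<close> and \<open>A h^3 = 1\<close>. In the second
  \<open>h\<close> need not be rational, but \<open>(x1 - h) h\<close> is, and it carries the
  relation down to the rational functions.\<close>

lemma curve2_frobenius_relation:
  fixes A :: "'a::finite_field poly"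
  assumes three: "(3 :: 'a) \<noteq> 0" and A: "A \<noteq> 0" and x1: "x1 \<noteq> 0"
    and iso: "isotriviality (curve2 A) E1 \<phi>"
    and orbit: "geom_point (Some (x1, y1)) \<in> frob_orbit \<phi> (geom_point R)" "R \<noteq> Some (x1, y1)"
  obtains i x0 y0 where "i > 0" "R = Some (x0, y0)"
    "x1 ^ 3 = to_fract A ^ (CARD('a) ^ i - 1) * x0 ^ (3 * CARD('a) ^ i)"
  | i x0 y0 w where "i > 0" "R = Some (x0, y0)"
    "to_fract A * x1 ^ 3 = to_fract A ^ 2 * w ^ 3 + 1 + 3 * (to_fract A * x1) * w"
    "w ^ 3 = to_fract A ^ (CARD('a) ^ i - 2) * x0 ^ (3 * CARD('a) ^ i)"
proof -
  obtain c a1 a3 d a2 a4 a6 u r v s w l where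
    E1: "E1 = Cubic c a1 a3 d a2 a4 a6" and nz: "c \<noteq> 0" "d \<noteq> 0" "u \<noteq> 0" "v \<noteq> 0"
    and \<phi>: "\<phi> = affine_substitution u r v s w"
    and eq: "\<And>x y. cubic_eval (map_cubic (\<lambda>c. to_ac (const_ratfun c)) E1) (u * x + r) (v * y + s * x + w) =
            l * cubic_eval (map_cubic to_ac (curve2 A)) x y"
    using isotrivialityE[OF iso] by metis
  let ?k = "\<lambda>c. to_ac (const_ratfun c) :: 'a ratfun alg_closure"
  note eqs = cubic_substitution_coeffs[OF infinite_ratfun_closure
      eq[unfolded E1 curve2_def cubic.map], simplified]
  obtain i x0 y0 where i: "i > 0" "R = Some (x0, y0)"
    "u * to_ac x1 + r = (u * to_ac x0 + r) ^ CARD('a) ^ i"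
    using frob_orbit_affine_substitution[OF nz(3,4) orbit[unfolded \<phi>]] by metis
  define N where "N = CARD('a) ^ i"
  have "N \<ge> 2" using i(1) CARD_gt_1[where ?'a = 'a]
    by (metis N_def Suc_1 Suc_leI one_less_power)
  interpret additive_power N "{x :: 'a ratfun alg_closure. x ^ N = x}"
    unfolding N_def by (rule additive_power_CARD)
  have K: "?k x \<in> {x. x ^ N = x}" for x by (simp add: N_def const_ratfun_power_CARD)
  define a where "a = to_fract A"
  define M where "M = a ^ (N - 1) * x0 ^ (3 * N)"
  have "a \<noteq> 0" using A by (simp add: a_def)
  obtain h where h: "(to_ac x1 - h) ^ 3 = to_ac M" "h = 0 \<or> to_ac a * h ^ 3 = 1"
    unfolding M_def a_def to_ac_mult to_ac_power
    by (rule frobenius_x_coordinate[of "?k c" "?k a1" "?k a3" "?k d" "?k a2" "?k a4" "?k a6"])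
      (use K three nz A eqs i(3) in \<open>simp_all add: N_def numeral_ratfun_closure_eq_0_iff\<close>)
  show ?thesis
  proof (cases "h = 0")
    case True
    hence "to_ac (x1 ^ 3) = to_ac M" using h by simp
    hence "x1 ^ 3 = M" by (simp only: to_ac_eq_iff)
    thus ?thesis using that(1) i by (simp add: N_def M_def a_def)
  next
    case False
    define W where "W = (to_ac x1 - h) * h"
    \<comment> \<open>Obtained by solving \<open>x1^3 = (x1 - h)^3 + h^3 + 3 x1 W\<close> for
      \<open>W\<close>, both cubes being rational.\<close>
    define w where "w = (x1 ^ 3 - M - 1 / a) / (3 * x1)"
    have h3: "h ^ 3 = to_ac (1 / a)"
      using h(2) False \<open>a \<noteq> 0\<close> by (simp add: eq_divide_eq mult.commute)
    have three': "(3 :: 'a ratfun alg_closure) \<noteq> 0"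
      using three by (simp add: numeral_ratfun_closure_eq_0_iff)
    hence three'': "(3 :: 'a ratfun) \<noteq> 0" by (metis to_ac_0 to_ac_numeral)
    have "to_ac x1 ^ 3 = (to_ac x1 - h) ^ 3 + h ^ 3 + 3 * to_ac x1 * W"
      by (simp add: W_def algebra_simps power3_eq_cube)
    hence "W * to_ac (3 * x1) = to_ac (x1 ^ 3 - M - 1 / a)"
      by (simp add: h h3 mult.commute)
    hence W: "W = to_ac w"
      using x1 three' by (simp only: w_def to_ac_divide eq_divide_eq) simp
    have "W ^ 3 = to_ac (M * (1 / a))"
      by (simp only: W_def power_mult_distrib h h3 to_ac_mult)
    hence "to_ac (w ^ 3) = to_ac (M / a)" by (simp add: W)
    hence w3: "w ^ 3 = M / a" by (simp only: to_ac_eq_iff)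
    \<comment> \<open>Because \<open>N\<close> is at least 2, the division by \<open>a\<close>
      leaves a nonnegative exponent, so \<open>w^3\<close> is a polynomial whenever
      \<open>x0\<close> is.\<close>
    have "N - 1 = Suc (N - 2)" using \<open>N \<ge> 2\<close> by simp
    hence "w ^ 3 = a ^ (N - 2) * x0 ^ (3 * N)"
      using \<open>a \<noteq> 0\<close> unfolding w3 M_def by simp
    moreover have "a * x1 ^ 3 = a\<^sup>2 * w ^ 3 + 1 + 3 * (a * x1) * w"
    proof -
      have "3 * (a * x1) * w = a * (3 * x1 * w)" by (simp add: mult_ac)
      also have "3 * x1 * w = x1 ^ 3 - M - 1 / a" using x1 three'' by (simp add: w_def)
      also have "a * \<dots> = a * x1 ^ 3 - a * M - 1"
        using \<open>a \<noteq> 0\<close> by (simp add: right_diff_distrib)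
      finally show ?thesis using \<open>a \<noteq> 0\<close> by (simp add: w3 power2_eq_square)
    qed
    ultimately show ?thesis using that(2)[OF i(1,2)] unfolding N_def a_def by blast
  qed
qed

subsection \<open>Separable integral points\<close>

text \<open>The name refers to the j-invariant. A singular point has \<open>y = 0\<close> and
  nonzero \<open>x\<close>, hence \<open>x^2 = 1\<close>, and \<open>3 x^2 = 1\<close> then forces
  \<open>2 = 0\<close>.\<close>

lemma elliptic_curve_twisted_1728:
  assumes "a \<noteq> 0" "(2 :: 'k::field) \<noteq> 0"
  shows "elliptic_curve (Cubic a 0 0 1 0 (- 1) (0 :: 'k))"
proof -
  have two: "(2 :: 'k alg_closure) \<noteq> 0" using assms(2) by (metis to_ac_eq_0_iff to_ac_numeral)
  have False
    if eqs: "to_ac a * y\<^sup>2 = x ^ 3 - x" "3 * x\<^sup>2 = 1" "2 * to_ac a * y = 0" for x y :: "'k alg_closure"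
  proof -
    have "y = 0" using eqs(3) assms(1) two by simp
    hence "x * (x\<^sup>2 - 1) = 0" using eqs(1) by (simp add: power2_eq_square power3_eq_cube algebra_simps)
    moreover have "x \<noteq> 0" using eqs(2) by auto
    ultimately have "x\<^sup>2 = 1" by simp
    hence "(3 :: 'k alg_closure) = 1" using eqs(2) by simp
    hence "1 + 2 = (1 :: 'k alg_closure)" by simp
    thus False using two by (simp only: add_cancel_left_right)
  qed
  thus ?thesis using assms(1) by (auto simp: elliptic_curve_def)
qed

lemma elliptic_curve_twisted_0:
  assumes "a \<noteq> 0" "(3 :: 'k::field) \<noteq> 0"
  shows "elliptic_curve (Cubic 1 0 (- 1) a 0 0 (0 :: 'k))"
proof -
  have three: "(3 :: 'k alg_closure) \<noteq> 0" using assms(2) by (metis to_ac_eq_0_iff to_ac_numeral)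
  have False
    if eqs: "y\<^sup>2 - y = to_ac a * x ^ 3" "3 * to_ac a * x\<^sup>2 = 0" "2 * y = 1" for x y :: "'k alg_closure"
  proof -
    have "x = 0" using eqs(2) assms(1) three by simp
    hence "y * (y - 1) = 0" using eqs(1) by (simp add: power2_eq_square algebra_simps)
    hence "y = 0 \<or> y = 1" by simp
    moreover have "y + y = 1" using eqs(3) by simp
    ultimately show False by (metis add_cancel_right_right zero_neq_one)
  qed
  thus ?thesis using assms(1) by (auto simp: elliptic_curve_def)
qed

section \<open>Isotriviality: a square or cube root of \<open>A\<close> untwists the curve\<close>

lemma alg_closed_nth_root:
  fixes a :: "'k::alg_closed_field"
  assumes "n > 0"
  obtains z where "z ^ n = a"
proof -
  have "degree (monom 1 n + [:- a:]) = n"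
    using assms by (subst degree_add_eq_left) (simp_all add: degree_monom_eq)
  hence "\<exists>z. poly (monom 1 n + [:- a:]) z = 0"
    using assms by (intro alg_closed_imp_poly_has_root) simp
  thus ?thesis using that by (auto simp: poly_monom)
qed

lemma isotrivial_curve1:
  fixes A :: "'a::field poly"
  assumes "A \<noteq> 0" "(2 :: 'a) \<noteq> 0"
  shows "isotrivial (curve1 A)"
proof -
  obtain v where v: "v ^ 2 = to_ac (to_fract A)" using alg_closed_nth_root[of 2] by auto
  have "isotriviality (curve1 A) (Cubic 1 0 0 1 0 (- 1) 0) (affine_substitution 1 0 v 0 0)"
    unfolding isotriviality_def
  proof
    show "elliptic_curve (Cubic 1 0 0 1 0 (- 1) (0 :: 'a))"
      using assms by (intro elliptic_curve_twisted_1728) auto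
    show "cubic_iso (affine_substitution 1 0 v 0 0) (map_cubic to_ac (curve1 A))
        (map_cubic (\<lambda>c. to_ac (const_ratfun c)) (Cubic 1 0 0 1 0 (- 1) 0))"
      unfolding cubic_iso_def affine_substitution_def
      by (rule exI[of _ 1], rule exI[of _ 0], rule exI[of _ v], rule exI[of _ 0], rule exI[of _ 0],
          rule exI[of _ 1])
        (use v assms in \<open>auto simp: curve1_def power_mult_distrib\<close>)
  qed
  moreover have "(2 :: 'a ratfun) \<noteq> 0"
    using assms(2) numeral_ratfun_closure_eq_0_iff[of "num.Bit0 num.One", where ?'a = 'a]
    by (metis to_ac_0 to_ac_numeral)
  hence "elliptic_curve (curve1 A)"
    unfolding curve1_def using assms by (intro elliptic_curve_twisted_1728) auto
  ultimately show ?thesis by (auto simp: isotrivial_def)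
qed

lemma isotrivial_curve2:
  fixes A :: "'a::field poly"
  assumes "A \<noteq> 0" "(3 :: 'a) \<noteq> 0"
  shows "isotrivial (curve2 A)"
proof -
  obtain u where u: "u ^ 3 = to_ac (to_fract A)" using alg_closed_nth_root[of 3] by auto
  have "isotriviality (curve2 A) (Cubic 1 0 (- 1) 1 0 0 0) (affine_substitution u 0 1 0 0)"
    unfolding isotriviality_def
  proof
    show "elliptic_curve (Cubic 1 0 (- 1) 1 0 0 (0 :: 'a))"
      using assms by (intro elliptic_curve_twisted_0) auto
    show "cubic_iso (affine_substitution u 0 1 0 0) (map_cubic to_ac (curve2 A))
        (map_cubic (\<lambda>c. to_ac (const_ratfun c)) (Cubic 1 0 (- 1) 1 0 0 0))"
      unfolding cubic_iso_def affine_substitution_def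
      by (rule exI[of _ u], rule exI[of _ 0], rule exI[of _ 1], rule exI[of _ 0], rule exI[of _ 0],
          rule exI[of _ 1])
        (use u assms in \<open>auto simp: curve2_def power_mult_distrib\<close>)
  qed
  moreover have "(3 :: 'a ratfun) \<noteq> 0"
    using assms(2) numeral_ratfun_closure_eq_0_iff[of "num.Bit1 num.One", where ?'a = 'a]
    by (metis to_ac_0 to_ac_numeral)
  hence "elliptic_curve (curve2 A)"
    unfolding curve2_def using assms by (intro elliptic_curve_twisted_0) auto
  ultimately show ?thesis by (auto simp: isotrivial_def)
qed

lemma nonconstant_point:
  assumes "degree F > 0 \<or> degree G > 0"
  shows "\<not> constant_point (Some (to_fract F, to_fract G))"
  using assms by (auto simp: constant_point_def const_ratfun_def)

section \<open>Separability of the explicit points\<close>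

context
  fixes A0 A f :: "'a::finite_field poly" and m :: nat
  assumes A0: "A = linearized A0" and as: "artin_schreier A f m"
begin

interpretation artin_schreier A f m by (rule as)

text \<open>With \<open>Q - 1 = 4 j + 2\<close> the exponents are \<open>(Q-1)/2\<close> and
  \<open>(Q-3)/4\<close>. The set \<open>U\<close> is kept variable so that one argument covers both
  integral and arbitrary competitors.\<close>

lemma curve1_separable:
  assumes two: "(2 :: 'a) \<noteq> 0" and m: "m = 4 * j + 2"
    and P: "P = Some (to_fract (f ^ (2 * j + 1)), to_fract (f ^ j))"
  shows "P \<in> integral_points (curve1 A)"
    and "U \<subseteq> points (curve1 A) \<Longrightarrow> U \<subseteq> integral_points (curve1 A) \<or> coeff A0 0 \<noteq> 0 \<Longrightarrow>
           separable_among U (curve1 A) P"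
proof -
  define a where "a = to_fract f"
  have "to_fract A = a * (a ^ (4 * j + 2) - 1)" by (simp add: A m a_def)
  hence "cubic_eval (curve1 A) (a ^ (2 * j + 1)) (a ^ j) =
      a * (a ^ (4 * j + 2) - 1) * (a ^ j)\<^sup>2 - ((a ^ (2 * j + 1)) ^ 3 - a ^ (2 * j + 1))"
    by (simp add: curve1_def)
  also have "\<dots> = 0"
    by (simp add: algebra_simps power_add power_mult power2_eq_square power3_eq_cube eval_nat_numeral
        power_mult_distrib)
  finally have "cubic_eval (curve1 A) (a ^ (2 * j + 1)) (a ^ j) = 0" .
  moreover have "P = Some (a ^ (2 * j + 1), a ^ j)" by (simp add: P a_def)
  ultimately show P': "P \<in> integral_points (curve1 A)"
    unfolding integral_points_def points_def using P by blast
  assume U: "U \<subseteq> points (curve1 A)" "U \<subseteq> integral_points (curve1 A) \<or> coeff A0 0 \<noteq> 0"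
  have "degree (f ^ (2 * j + 1)) > 0" using deg by (subst degree_power_eq) auto
  hence "\<not> constant_point P" unfolding P by (intro nonconstant_point) blast
  moreover have "P \<in> points (curve1 A)" using P' by (simp add: integral_points_def)
  moreover have "geom_point P \<notin> frob_orbit \<phi> (geom_point R)"
    if iso: "isotriviality (curve1 A) E1 \<phi>" and R: "R \<in> U" "R \<noteq> P" for E1 \<phi> R
  proof
    assume orbit: "geom_point P \<in> frob_orbit \<phi> (geom_point R)"
    obtain i x0 y0 where i: "i > 0" and R': "R = Some (x0, y0)"
      and eq: "to_fract (f ^ j) ^ 4 = to_fract A ^ (2 * (CARD('a) ^ i - 1)) * y0 ^ (4 * CARD('a) ^ i)"
      using curve1_frobenius_relation[OF two iso orbit[unfolded P] R(2)[unfolded P]] by metis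
    define N where "N = CARD('a) ^ i"
    have N: "N \<ge> 2" using i CARD_gt_1[where ?'a = 'a]
      by (metis N_def Suc_1 Suc_leI one_less_power)
    have rel: "to_fract (f ^ (j * 4)) = to_fract A ^ (2 * (N - 1)) * y0 ^ (4 * N)"
      using eq by (simp add: N_def power_mult)
    have pos: "2 * (N - 1) > 0" "4 * N > 0" using N by auto
    \<comment> \<open>This disposes of all integral competitors; for the others the multiplicity of
      a prime is needed.\<close>
    have "y0 \<notin> range to_fract" by (rule power_relation(1)[OF rel pos])
    hence "R \<notin> integral_points (curve1 A)" by (auto simp: integral_points_def R')
    with U R(1) have "coeff A0 0 \<noteq> 0" by blast
    obtain \<pi> e r where e: "prime_elem \<pi>" "A = \<pi> ^ e * r" "\<not> \<pi> dvd r" "e > 0"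
      "4 * N dvd 2 * (N - 1) * e"
      using power_relation(2)[OF rel pos] by blast
    have "e = 1"
      using exact_power_linearized[OF e(1) _ e(3,4) \<open>coeff A0 0 \<noteq> 0\<close>] e(2) A0 by simp
    hence "4 * N \<le> 2 * (N - 1)" using e(5) pos by (intro dvd_imp_le) auto
    thus False using N by simp
  qed
  ultimately show "separable_among U (curve1 A) P"
    using isotrivial_curve1[OF nonzero(1) two] by (auto simp: separable_among_def)
qed

text \<open>With \<open>Q - 1 = 3 j + 1\<close> the exponents are \<open>(Q-2)/3\<close> and
  \<open>Q - 1\<close>. Each form of the Frobenius relation excludes integral competitors by a pole
  and the remaining ones by the multiplicity \<open>e\<close>, which is 1 or
  \<open>q\<close>.\<close>

lemma curve2_separable:
  assumes q: "CARD('a) mod 3 = 2" and three: "(3 :: 'a) \<noteq> 0" and m: "m = 3 * j + 1"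
    and P: "P = Some (to_fract (f ^ j), to_fract (f ^ m))"
  shows "P \<in> integral_points (curve2 A)"
    and "U \<subseteq> points (curve2 A) \<Longrightarrow>
           U \<subseteq> integral_points (curve2 A) \<or> coeff A0 0 \<noteq> 0 \<or> coeff A0 1 \<noteq> 0 \<Longrightarrow>
           separable_among U (curve2 A) P"
proof -
  define a where "a = to_fract f"
  have "to_fract A = a * (a ^ (3 * j + 1) - 1)" by (simp add: A m a_def)
  hence "cubic_eval (curve2 A) (a ^ j) (a ^ (3 * j + 1)) =
      (a ^ (3 * j + 1))\<^sup>2 - a ^ (3 * j + 1) - a * (a ^ (3 * j + 1) - 1) * (a ^ j) ^ 3"
    by (simp add: curve2_def)
  also have "\<dots> = 0"
    by (simp add: algebra_simps power_add power_mult power2_eq_square power3_eq_cube eval_nat_numeral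
        power_mult_distrib)
  finally have "cubic_eval (curve2 A) (a ^ j) (a ^ (3 * j + 1)) = 0" .
  moreover have "P = Some (a ^ j, a ^ (3 * j + 1))" by (simp add: P a_def m)
  ultimately show P': "P \<in> integral_points (curve2 A)"
    unfolding integral_points_def points_def using P by blast
  assume U: "U \<subseteq> points (curve2 A)"
    "U \<subseteq> integral_points (curve2 A) \<or> coeff A0 0 \<noteq> 0 \<or> coeff A0 1 \<noteq> 0"
  have "degree (f ^ m) > 0" using deg m by (subst degree_power_eq) auto
  hence "\<not> constant_point P" unfolding P by (intro nonconstant_point) blast
  moreover have "P \<in> points (curve2 A)" using P' by (simp add: integral_points_def)
  moreover have "geom_point P \<notin> frob_orbit \<phi> (geom_point R)"
    if iso: "isotriviality (curve2 A) E1 \<phi>" and R: "R \<in> U" "R \<noteq> P" for E1 \<phi> R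
  proof
    assume orbit: "geom_point P \<in> frob_orbit \<phi> (geom_point R)"
    have e_cases: "e = 1 \<or> e = CARD('a)"
      if "prime_elem \<pi>" "A = \<pi> ^ e * r" "\<not> \<pi> dvd r" "e > 0" "coeff A0 0 \<noteq> 0 \<or> coeff A0 1 \<noteq> 0"
      for \<pi> e r
      using linearized_exact_power[OF that(1) _ that(3-5)] that(2) A0 by auto
    have nz: "to_fract (f ^ j) \<noteq> 0" using nonzero(2) by simp
    from curve2_frobenius_relation[OF three nonzero(1) nz iso orbit[unfolded P] R(2)[unfolded P]]
    show False
    proof cases
      case (1 i x0 y0)
      define N where "N = CARD('a) ^ i"
      have N: "N \<ge> 2" using 1(1) CARD_gt_1[where ?'a = 'a]
        by (metis N_def Suc_1 Suc_leI one_less_power)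
      have rel: "to_fract (f ^ (j * 3)) = to_fract A ^ (N - 1) * x0 ^ (3 * N)"
        using 1(3) by (simp add: N_def power_mult)
      have pos: "N - 1 > 0" "3 * N > 0" using N by auto
      have "x0 \<notin> range to_fract" by (rule power_relation(1)[OF rel pos])
      hence "R \<notin> integral_points (curve2 A)" by (auto simp: integral_points_def 1(2))
      with U R(1) have nz: "coeff A0 0 \<noteq> 0 \<or> coeff A0 1 \<noteq> 0" by blast
      obtain \<pi> e r where e: "prime_elem \<pi>" "A = \<pi> ^ e * r" "\<not> \<pi> dvd r" "e > 0"
        "3 * N dvd (N - 1) * e"
        using power_relation(2)[OF rel pos] by blast
      have "e \<noteq> 1"
      proof
        assume "e = 1"
        hence "3 * N \<le> N - 1" using e(5) pos by (intro dvd_imp_le) auto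
        thus False using N by simp
      qed
      hence "e = CARD('a)" using e_cases[OF e(1-4) nz] by simp
      \<comment> \<open>With \<open>N = N' q\<close> and \<open>e = q\<close> the divisibility
        becomes \<open>3 N' dvd N - 1\<close>. As \<open>N'\<close> divides \<open>N\<close> too, it
        is 1, so \<open>N = q\<close> and 3 divides \<open>q - 1\<close>.\<close>
      obtain i' where i': "i = Suc i'" using 1(1) gr0_implies_Suc by blast
      define N' where "N' = CARD('a) ^ i'"
      have N': "N = N' * e" by (simp add: N_def N'_def i' \<open>e = CARD('a)\<close>)
      hence "3 * N' dvd N - 1" using e(4,5) by (simp flip: mult.assoc)
      hence "3 dvd N - 1" "N' dvd N - 1" by (auto dest: dvd_mult_left dvd_mult_right)
      have "N' dvd N" using N' by simp
      hence "N' dvd N - (N - 1)" using \<open>N' dvd N - 1\<close> by (rule dvd_diff_nat)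
      moreover have "N - (N - 1) = 1" using N by linarith
      ultimately have "N' = 1" by simp
      hence "3 dvd CARD('a) - 1" using \<open>3 dvd N - 1\<close> N' \<open>e = CARD('a)\<close> by simp
      thus False using q by presburger
    next
      case (2 i x0 y0 w)
      have "to_fract (A * (f ^ j) ^ 3) = to_fract A ^ 2 * w ^ 3 + 1 + 3 * to_fract (A * f ^ j) * w"
        using 2(3) by simp
      note cardano = cardano_relation[OF this]
      have "R \<notin> integral_points (curve2 A)"
      proof
        assume "R \<in> integral_points (curve2 A)"
        then obtain g where "x0 = to_fract g" using 2(2) by (auto simp: integral_points_def)
        hence "w ^ 3 = to_fract (A ^ (CARD('a) ^ i - 2) * g ^ (3 * CARD('a) ^ i))"
          using 2(4) by simp
        thus False using cardano(1) by blast
      qed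
      with U R(1) have nz: "coeff A0 0 \<noteq> 0 \<or> coeff A0 1 \<noteq> 0" by blast
      obtain \<pi> e r where e: "prime_elem \<pi>" "A = \<pi> ^ e * r" "\<not> \<pi> dvd r" "e > 0" "3 dvd e"
        using cardano(2) by blast
      \<comment> \<open>Neither 1 nor \<open>q\<close>, which is 2 modulo 3, is divisible by
        3.\<close>
      with e_cases[OF e(1-4) nz] q show False by auto
    qed
  qed
  ultimately show "separable_among U (curve2 A) P"
    using isotrivial_curve2[OF nonzero(1) three] by (auto simp: separable_among_def)
qed

end

section \<open>Telling the points apart and counting them\<close>

lemma (in artin_schreier) degree_A: "degree A = degree f * (m + 1)"
proof -
  have "f ^ m \<noteq> 0" using nonzero by simp
  have "degree (f ^ m + (- 1)) = degree (f ^ m)"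
    using deg m by (intro degree_add_eq_left) (simp add: degree_power_eq nonzero)
  hence "degree (f ^ m - 1) = degree f * m" by (simp add: degree_power_eq nonzero mult.commute)
  moreover have "f ^ m - 1 \<noteq> 0" using degree_pos by auto
  ultimately show ?thesis by (simp add: A degree_mult_eq nonzero)
qed

text \<open>The degree of \<open>A\<close> exceeds \<open>degree f * m\<close> by
  \<open>degree f\<close>, so the product determines \<open>degree f\<close> and then
  \<open>m\<close>. A coordinate of the constructed point has this product, or half of it, as its
  degree.\<close>

lemma artin_schreier_inject:
  assumes "artin_schreier A f m" "artin_schreier A g n" "degree f * m = degree g * n"
  shows "m = n"
proof -
  interpret F: artin_schreier A f m by fact
  interpret G: artin_schreier A g n by fact
  have "degree f * m + degree f = degree g * n + degree g"
    using F.degree_A G.degree_A by simp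
  thus ?thesis using assms(3) F.deg by simp
qed

lemma linearized_artin_schreier:
  fixes A0 :: "'a::finite_field poly"
  assumes "A0 \<noteq> 0" "monom 1 k - 1 dvd A0" "k > 0"
  obtains f where "artin_schreier (linearized A0) f (CARD('a) ^ k - 1)"
proof -
  obtain B where B: "A0 = (monom 1 k - 1) * B" using assms(2) by blast
  define f where "f = linearized B"
  have "B \<noteq> 0" using assms(1) B by auto
  have q: "CARD('a) ^ k > 1" using assms(3) CARD_gt_1[where ?'a = 'a] by (intro one_less_power)
  have "linearized A0 = f ^ Suc (CARD('a) ^ k - 1) - f"
    using linearized_factor[OF B] q by (simp add: f_def)
  hence "linearized A0 = f * (f ^ (CARD('a) ^ k - 1) - 1)"
    by (simp only: power_Suc right_diff_distrib mult_1_right)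
  moreover have "degree f > 0"
    using CARD_gt_1[where ?'a = 'a] by (simp add: f_def degree_linearized[OF \<open>B \<noteq> 0\<close>])
  ultimately show ?thesis using q by (intro that[of f]) (simp add: artin_schreier_def)
qed

lemma numeral_neq_0_finite_field:
  assumes "prime (numeral p :: nat)" "\<not> numeral p dvd CARD('a::finite_field)"
  shows "(numeral p :: 'a) \<noteq> 0"
proof
  assume "(numeral p :: 'a) = 0"
  hence "of_nat (numeral p) = (0 :: 'a)" by simp
  hence "CHAR('a) dvd numeral p" by (simp only: of_nat_eq_0_iff_char_dvd)
  moreover have "CHAR('a) \<noteq> 1" by simp
  ultimately have "CHAR('a) = numeral p" using assms(1) by (metis prime_nat_iff)
  moreover have "CHAR('a) dvd CARD('a)"
    using of_nat_CARD_eq_0[where ?'a = 'a] by (simp only: of_nat_eq_0_iff_char_dvd)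
  ultimately show False using assms(2) by simp
qed

text \<open>Separability among integral points holds throughout. Against all rational points a
  condition on the lowest coefficients bounds the prime multiplicities of \<open>A\<close>; on the
  first curve it excludes the example given before \<open>separable_among\<close>, where
  \<open>A0 = t^2 - t\<close>.\<close>

theorem theorem2p13:
  fixes A0 A :: "'a::finite_field poly" and k :: "nat \<Rightarrow> nat" and n q :: nat
  assumes "q = CARD('a)"
    and "inj_on k {1..n}"
    and "\<And>i. i \<in> {1..n} \<Longrightarrow> odd (k i)"
    and "A0 \<noteq> 0"
    and "\<And>i. i \<in> {1..n} \<Longrightarrow> monom 1 (k i) - 1 dvd A0"
    and "A = linearized A0"
  shows "(q mod 4 = 3 \<longrightarrow>
           (\<exists>S. finite S \<and> card S = n \<and> S \<subseteq> integral_points (curve1 A) \<and>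
             (\<forall>P\<in>S. integrally_separable_point (curve1 A) P \<and>
                    (coeff A0 0 \<noteq> 0 \<longrightarrow> separable_point (curve1 A) P)))) \<and>
         (q mod 3 = 2 \<longrightarrow>
           (\<exists>S. finite S \<and> card S = n \<and> S \<subseteq> integral_points (curve2 A) \<and>
             (\<forall>P\<in>S. integrally_separable_point (curve2 A) P \<and>
                    (coeff A0 0 \<noteq> 0 \<or> coeff A0 1 \<noteq> 0 \<longrightarrow> separable_point (curve2 A) P))))"
proof -
  have q1: "q > 1" using assms(1) CARD_gt_1[where ?'a = 'a] by simp
  define m where "m i = q ^ k i - 1" for i
  have "\<forall>i\<in>{1..n}. \<exists>f. artin_schreier A f (m i)"
  proof
    fix i assume i: "i \<in> {1..n}"
    hence "k i > 0" using assms(3) odd_pos by blast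
    thus "\<exists>f. artin_schreier A f (m i)"
      using linearized_artin_schreier[OF assms(4) assms(5)[OF i]] by (metis assms(1,6) m_def)
  qed
  then obtain f where f: "artin_schreier A (f i) (m i)" if "i \<in> {1..n}" for i by metis
  have f_nz: "f i \<noteq> 0" if "i \<in> {1..n}" for i
    using artin_schreier.nonzero(2)[OF f[OF that]] .
  have inj: "i = j" if "i \<in> {1..n}" "j \<in> {1..n}" "degree (f i) * m i = degree (f j) * m j" for i j
  proof -
    have "m i = m j" using artin_schreier_inject[OF f f] that by blast
    hence "q ^ k i = q ^ k j" unfolding m_def using q1
      by (metis Suc_pred' less_trans zero_less_one zero_less_power)
    hence "k i = k j" using q1 by (simp add: power_inject_exp)
    thus ?thesis using assms(2) that by (auto dest: inj_onD)
  qed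
  have subset: "integral_points E \<subseteq> points E" for E :: "'a ratfun cubic"
    by (auto simp: integral_points_def)
  show ?thesis
  proof (intro conjI impI)
    assume q: "q mod 4 = 3"
    hence "odd q" by presburger
    hence two: "(2 :: 'a) \<noteq> 0"
      using numeral_neq_0_finite_field[of "num.Bit0 num.One", where ?'a = 'a] assms(1) by simp
    \<comment> \<open>Oddness of \<open>k i\<close> enters here: odd powers of 3 are 3 modulo
      4.\<close>
    have m4: "m i = 4 * (m i div 4) + 2" if "i \<in> {1..n}" for i
    proof -
      have "odd (k i)" using assms(3) that by blast
      then obtain l where l: "k i = 2 * l + 1" by (rule oddE)
      have "q ^ k i mod 4 = (q mod 4) ^ k i mod 4" by (simp add: power_mod)
      also have "\<dots> = 3 ^ k i mod 4" by (simp only: q)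
      also have "(3 :: nat) ^ k i = 9 ^ l * 3" by (simp add: l power_mult)
      also have "\<dots> mod 4 = (9 ^ l mod 4) * 3 mod 4" by (simp only: mod_mult_left_eq)
      also have "(9 :: nat) ^ l mod 4 = (9 mod 4) ^ l mod 4" by (simp only: power_mod)
      also have "\<dots> * 3 mod 4 = (3 :: nat)" by simp
      finally have "q ^ k i mod 4 = 3" .
      thus ?thesis unfolding m_def by presburger
    qed
    define P where "P i = Some (to_fract (f i ^ (2 * (m i div 4) + 1)), to_fract (f i ^ (m i div 4)))" for i
    have "inj_on P {1..n}"
    proof
      fix i j assume ij: "i \<in> {1..n}" "j \<in> {1..n}" "P i = P j"
      hence "f i ^ (2 * (m i div 4) + 1) = f j ^ (2 * (m j div 4) + 1)"
        by (simp only: P_def option.inject prod.inject to_fract_eq_iff)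
      hence "(2 * (m i div 4) + 1) * degree (f i) = (2 * (m j div 4) + 1) * degree (f j)"
        using ij f_nz by (metis degree_power_eq)
      \<comment> \<open>Doubling the degree of the first coordinate recovers the product with
        \<open>m i\<close>.\<close>
      hence "degree (f i) * (4 * (m i div 4) + 2) = degree (f j) * (4 * (m j div 4) + 2)"
        by (simp add: algebra_simps)
      hence "degree (f i) * m i = degree (f j) * m j" using m4 ij by metis
      thus "i = j" using inj ij by blast
    qed
    moreover have "P i \<in> integral_points (curve1 A)" if "i \<in> {1..n}" for i
      by (rule curve1_separable(1)[OF assms(6) f[OF that] two m4[OF that] P_def])
    moreover have "integrally_separable_point (curve1 A) (P i)" if "i \<in> {1..n}" for i
      unfolding integrally_separable_point_def
      by (rule curve1_separable(2)[OF assms(6) f[OF that] two m4[OF that] P_def])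
        (simp_all add: subset)
    moreover have "separable_point (curve1 A) (P i)"
      if "i \<in> {1..n}" "coeff A0 0 \<noteq> 0" for i
      unfolding separable_point_def
      by (rule curve1_separable(2)[OF assms(6) f[OF that(1)] two m4[OF that(1)] P_def])
        (use that(2) in simp_all)
    ultimately show "\<exists>S. finite S \<and> card S = n \<and> S \<subseteq> integral_points (curve1 A) \<and>
             (\<forall>P\<in>S. integrally_separable_point (curve1 A) P \<and>
                    (coeff A0 0 \<noteq> 0 \<longrightarrow> separable_point (curve1 A) P))"
      by (intro exI[of _ "P ` {1..n}"]) (auto simp: card_image)
  next
    assume q: "q mod 3 = 2"
    have three: "(3 :: 'a) \<noteq> 0"
      using numeral_neq_0_finite_field[of "num.Bit1 num.One", where ?'a = 'a] assms(1) q
      by (simp add: dvd_eq_mod_eq_0)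
    \<comment> \<open>Again by oddness of \<open>k i\<close>: odd powers of 2 are 2 modulo
      3.\<close>
    have m3: "m i = 3 * (m i div 3) + 1" if "i \<in> {1..n}" for i
    proof -
      have "odd (k i)" using assms(3) that by blast
      then obtain l where l: "k i = 2 * l + 1" by (rule oddE)
      have "q ^ k i mod 3 = (q mod 3) ^ k i mod 3" by (simp add: power_mod)
      also have "\<dots> = 2 ^ k i mod 3" by (simp only: q)
      also have "(2 :: nat) ^ k i = 4 ^ l * 2" by (simp add: l power_mult)
      also have "\<dots> mod 3 = (4 ^ l mod 3) * 2 mod 3" by (simp only: mod_mult_left_eq)
      also have "(4 :: nat) ^ l mod 3 = (4 mod 3) ^ l mod 3" by (simp only: power_mod)
      also have "\<dots> * 2 mod 3 = (2 :: nat)" by simp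
      finally have "q ^ k i mod 3 = 2" .
      thus ?thesis unfolding m_def by presburger
    qed
    define P where "P i = Some (to_fract (f i ^ (m i div 3)), to_fract (f i ^ m i))" for i
    have "inj_on P {1..n}"
    proof
      fix i j assume ij: "i \<in> {1..n}" "j \<in> {1..n}" "P i = P j"
      hence "f i ^ m i = f j ^ m j"
        by (simp only: P_def option.inject prod.inject to_fract_eq_iff)
      hence "m i * degree (f i) = m j * degree (f j)"
        using ij f_nz by (metis degree_power_eq)
      thus "i = j" using inj ij by (simp add: mult.commute)
    qed
    moreover have "P i \<in> integral_points (curve2 A)" if "i \<in> {1..n}" for i
      by (rule curve2_separable(1)[OF assms(6) f[OF that] q[unfolded assms(1)] three m3[OF that] P_def])
    moreover have "integrally_separable_point (curve2 A) (P i)" if "i \<in> {1..n}" for i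
      unfolding integrally_separable_point_def
      by (rule curve2_separable(2)[OF assms(6) f[OF that] q[unfolded assms(1)] three m3[OF that] P_def])
        (simp_all add: subset)
    moreover have "separable_point (curve2 A) (P i)"
      if "i \<in> {1..n}" "coeff A0 0 \<noteq> 0 \<or> coeff A0 1 \<noteq> 0" for i
      unfolding separable_point_def
      by (rule curve2_separable(2)[OF assms(6) f[OF that(1)] q[unfolded assms(1)] three m3[OF that(1)] P_def])
        (use that(2) in simp_all)
    ultimately show "\<exists>S. finite S \<and> card S = n \<and> S \<subseteq> integral_points (curve2 A) \<and>
             (\<forall>P\<in>S. integrally_separable_point (curve2 A) P \<and>
                    (coeff A0 0 \<noteq> 0 \<or> coeff A0 1 \<noteq> 0 \<longrightarrow> separable_point (curve2 A) P))"
      by (intro exI[of _ "P ` {1..n}"]) (auto simp: card_image)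
  qed
qed

end
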